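(* Let $v(x,y)$ be a $C^\infty$-smooth non-vanishing function in a neighborhood of the point $q=(0,y_0)$ of the $(x,y)$-plane. Let $M=\sum_{i=0}^3\mu_i(x,y)p^i$ with $$\mu_3=v^3-x\,v^2v_x,\quad\mu_2=-2x^2v_y,\quad\mu_1=v-2x\,v_x,\quad\mu_0=0,$$ and let $\vec V$ be the vector field in $(x,y,p)$-space $$\dot x=xv,\quad\dot y=2x^2vp,\quad\dot p=M .$$ Then the germ of $\vec V$ at the singular point $(q,p_0)$ with $p_0=0$, i.e. $(x,y,p)=(0,y_0,0)$, is smoothly orbitally equivalent to $$\dot\xi=\xi,\quad\dot\eta=\eta,\quad\dot\zeta=0 .$$
   Context: "Smooth" means $C^\infty$. Subscripts $x,y$ denote partial derivatives. The field $\vec V$ arises from geodesics of the almost-Riemannian metric with orthonormal frame $\partial_x,\ 2x\,v^{-1}(x,y)\,\partial_y$, i.e. $ds^2=dx^2+\frac{v^2}{4x^2}dy^2$, after the substitution $t=x^2$, $p=dy/dt$; the coefficients are $\mu_i(x,y)=\widetilde\mu_i(x^2,y)$, where $\widetilde\mu_3=\widetilde v^3-2t\widetilde v^2\widetilde v_t$, $\widetilde\mu_2=-2t\widetilde v_y$, $\widetilde\mu_1=\widetilde v-4t\widetilde v_t$, $\widetilde\mu_0=0$ and $\widetilde v(t,y)=v(\sqrt t,y)$, which after $t=x^2$ gives the formulas in the claim. Two germs of vector fields are smoothly orbitally equivalent if a germ of a $C^\infty$-diffeomorphism takes one of them to the other multiplied by a non-vanishing $C^\infty$ function; here the germ of $\vec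 V$ at the singular point is compared with the germ of the normal form at the origin of $(\xi,\eta,\zeta)$-space. *)

theory Defs
  imports "HOL-Analysis.Analysis"
begin

text \<open>
  The two predicates below are meant for open \<open>S\<close> only, since the derivative is taken at \<open>x\<close>
  rather than within \<open>S\<close>. All iterated directional derivatives exist and are continuous, which
  in finite dimension is the class \<open>C\<^sup>n\<close>.
\<close>

primrec Ck_on :: "nat \<Rightarrow> 'a::euclidean_space set \<Rightarrow> ('a \<Rightarrow> 'b::euclidean_space) \<Rightarrow> bool" where
  "Ck_on 0 S f \<longleftrightarrow> continuous_on S f"
| "Ck_on (Suc n) S f \<longleftrightarrow>
     (\<forall>x\<in>S. f differentiable (at x)) \<and>
     (\<forall>h. Ck_on n S (\<lambda>x. frechet_derivative f (at x) h))"

definition smooth_on :: "'a::euclidean_space set \<Rightarrow> ('a \<Rightarrow> 'b::euclidean_space) \<Rightarrow> bool" where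
  "smooth_on S f \<longleftrightarrow> (\<forall>n. Ck_on n S f)"

definition diffeomorphism ::
    "'a::euclidean_space set \<Rightarrow> 'b::euclidean_space set \<Rightarrow> ('a \<Rightarrow> 'b) \<Rightarrow> ('b \<Rightarrow> 'a) \<Rightarrow> bool" where
  "diffeomorphism S T \<Phi> \<Psi> \<longleftrightarrow>
     open S \<and> open T \<and> homeomorphism S T \<Phi> \<Psi> \<and> smooth_on S \<Phi> \<and> smooth_on T \<Psi>"

text \<open>
  The germ of \<open>V\<close> at \<open>a\<close> and the germ of \<open>W\<close> at \<open>b\<close>: on some neighbourhood of \<open>a\<close>, the
  differential of \<open>\<Phi>\<close> sends \<open>V\<close> to a non-vanishing smooth multiple of \<open>W\<close> along \<open>\<Phi>\<close>.
\<close>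

definition smoothly_orbitally_equivalent ::
    "('a::euclidean_space \<Rightarrow> 'a) \<Rightarrow> 'a \<Rightarrow> ('b::euclidean_space \<Rightarrow> 'b) \<Rightarrow> 'b \<Rightarrow> bool" where
  "smoothly_orbitally_equivalent V a W b \<longleftrightarrow>
     (\<exists>S T \<Phi> \<Psi> (\<phi> :: 'a \<Rightarrow> real).
        diffeomorphism S T \<Phi> \<Psi> \<and> a \<in> S \<and> \<Phi> a = b \<and>
        smooth_on S \<phi> \<and> (\<forall>z\<in>S. \<phi> z \<noteq> 0) \<and>
        (\<forall>z\<in>S. frechet_derivative \<Phi> (at z) (V z) = \<phi> z *\<^sub>R W (\<Phi> z)))"

definition partial_x :: "(real \<times> real \<Rightarrow> real) \<Rightarrow> real \<Rightarrow> real \<Rightarrow> real" where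
  "partial_x v x y = deriv (\<lambda>s. v (s, y)) x"

definition partial_y :: "(real \<times> real \<Rightarrow> real) \<Rightarrow> real \<Rightarrow> real \<Rightarrow> real" where
  "partial_y v x y = deriv (\<lambda>s. v (x, s)) y"

definition mu :: "(real \<times> real \<Rightarrow> real) \<Rightarrow> nat \<Rightarrow> real \<Rightarrow> real \<Rightarrow> real" where
  "mu v i x y =
     (if i = 3 then v (x, y) ^ 3 - x * v (x, y) ^ 2 * partial_x v x y
      else if i = 2 then - 2 * x ^ 2 * partial_y v x y
      else if i = 1 then v (x, y) - 2 * x * partial_x v x y
      else 0)"

definition M_poly :: "(real \<times> real \<Rightarrow> real) \<Rightarrow> real \<Rightarrow> real \<Rightarrow> real \<Rightarrow> real" where
  "M_poly v x y p = (\<Sum>i = 0..3. mu v i x y * p ^ i)"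

definition geodesic_field ::
    "(real \<times> real \<Rightarrow> real) \<Rightarrow> real \<times> real \<times> real \<Rightarrow> real \<times> real \<times> real" where
  "geodesic_field v = (\<lambda>(x, y, p). (x * v (x, y), 2 * x ^ 2 * v (x, y) * p, M_poly v x y p))"

definition normal_form :: "real \<times> real \<times> real \<Rightarrow> real \<times> real \<times> real" where
  "normal_form = (\<lambda>(\<xi>, \<eta>, \<zeta>). (\<xi>, \<eta>, 0))"

lemma geodesic_field_singular: "geodesic_field v (0, y0, 0) = 0"
  by (simp add: geodesic_field_def M_poly_def mu_def numeral_3_eq_3 zero_prod_def)

end

theory Submission imports Defs begin

text \<open>
  Dividing \<open>V\<close> by \<open>v\<close> gives \<open>x' = x\<close>, so orbits can be parametrised by \<open>x = s \<xi>\<close>. Writing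
  \<open>y = y\<^sub>0 + \<zeta> + a\<close> and \<open>p = s \<eta> e\<^sup>q\<close> along the ray \<open>s \<mapsto> (s \<xi>, s \<eta>, \<zeta>)\<close>, the singular system for
  \<open>(y, p)\<close> turns into a regular one for \<open>u = (a, q)\<close>, because \<open>M / (v p) - 1\<close> vanishes for \<open>x = p = 0\<close>.
  In integrated form it is the fixed point equation
  \<open>u (\<lambda>) = \<integral>\<^sub>0\<^sup>1 F (s, \<lambda>, u (\<sigma>\<^sub>s \<lambda>)) ds\<close> with \<open>\<sigma>\<^sub>s (\<xi>, \<eta>, \<zeta>) = (s \<xi>, s \<eta>, \<zeta>)\<close>, in which \<open>F\<close> is small near
  the singular point. The Picard iterates converge in \<open>C\<^sup>1\<close>. A directional derivative of \<open>u\<close> along a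
  coordinate axis solves a linear equation of the same kind whose coefficients are as regular as \<open>u\<close>,
  so \<open>u\<close> is smooth by bootstrapping. The map \<open>\<Psi> (\<xi>, \<eta>, \<zeta>) = (\<xi>, y\<^sub>0 + \<zeta> + a, \<eta> e\<^sup>q)\<close> then takes the
  normal form to \<open>V / v\<close>, and its local inverse is the required equivalence.
\<close>

subsection \<open>The calculus of \<open>C\<^sup>k\<close> functions\<close>

text \<open>Since \<open>\<mu>\<^sub>0 = 0\<close> and \<open>\<mu>\<^sub>1 = v\<close> at x = 0,
  the field V / v vanishes on the line x = p = 0 and has the linear part (x, 0, p) there. The
  equality of the two nonzero eigenvalues is what makes M / (v p) - 1 vanish on that line, so that
  division by s is possible. The unknown u is a function of \<open>\<lambda>\<close> alone, the
  value at s = 1, so that smooth dependence on the ray is part of the regularity of u. This is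
  legitimate because \<open>F (s, \<sigma>\<^sub>\<tau> \<lambda>, a) = \<tau> F (\<tau> s,
  \<lambda>, a)\<close>: the value of u at \<open>\<sigma>\<^sub>\<tau> \<lambda>\<close> is the
  solution at time \<open>\<tau>\<close> on the ray of \<open>\<lambda>\<close>. The obstacle is to
  obtain all orders of differentiability on one neighbourhood, as a separate contraction argument
  for each order could shrink the radius. Derivatives along the axes avoid this:
  \<open>\<sigma>\<^sub>s\<close> multiplies an axis vector by a number of modulus at most 1, so
  differentiation changes the linear part only by that factor and the contraction constant 1/2
  survives at every order, on the same ball.\<close>

lemma Ck_on_cong:
  assumes "open S" "\<And>x. x \<in> S \<Longrightarrow> f x = g x" "Ck_on n S f"
  shows "Ck_on n S g"
  using assms(2,3)
proof (induction n arbitrary: f g)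
  case 0
  then show ?case by (simp cong: continuous_on_cong)
next
  case (Suc n)
  have df: "f differentiable (at x)" if "x \<in> S" for x
    using Suc.prems that by simp
  have dg: "g differentiable (at x)" if "x \<in> S" for x
    using df[OF that] \<open>open S\<close> that Suc.prems(1)
    unfolding differentiable_def by (meson has_derivative_transform_within_open)
  have eq: "frechet_derivative f (at x) = frechet_derivative g (at x)" if "x \<in> S" for x
    using frechet_derivative_transform_within_open[OF df[OF that] \<open>open S\<close> that] Suc.prems(1) by blast
  have "Ck_on n S (\<lambda>x. frechet_derivative g (at x) h)" for h
    by (rule Suc.IH[of "\<lambda>x. frechet_derivative f (at x) h"]) (use eq Suc.prems in auto)
  with dg show ?case by simp
qed

lemma Ck_on_subset: "Ck_on n S f \<Longrightarrow> T \<subseteq> S \<Longrightarrow> Ck_on n T f"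
  by (induction n arbitrary: f) (auto intro: continuous_on_subset)

lemma Ck_on_imp_continuous_on: "Ck_on n S f \<Longrightarrow> continuous_on S f"
proof (cases n)
  case (Suc m)
  then show "continuous_on S f" if "Ck_on n S f"
    using that by (simp add: continuous_at_imp_continuous_on differentiable_imp_continuous_within)
qed simp

lemma Ck_on_SucD: "Ck_on (Suc n) S f \<Longrightarrow> Ck_on n S f"
proof (induction n arbitrary: f)
  case 0
  then show ?case using Ck_on_imp_continuous_on[OF 0] by simp
next
  case (Suc n)
  then show ?case by (subst Ck_on.simps) (metis Ck_on.simps(2))
qed

lemma Ck_on_has_derivative:
  "Ck_on (Suc n) S f \<Longrightarrow> x \<in> S \<Longrightarrow> (f has_derivative frechet_derivative f (at x)) (at x)"
  using frechet_derivative_works by auto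

text \<open>Uniqueness of the derivative lets any explicit formula \<open>f'\<close> stand in for
  \<open>frechet_derivative\<close>, which is only given by choice.\<close>

lemma Ck_on_SucI:
  assumes "open S" "\<And>x. x \<in> S \<Longrightarrow> (f has_derivative f' x) (at x)" "\<And>h. Ck_on n S (\<lambda>x. f' x h)"
  shows "Ck_on (Suc n) S f"
proof -
  have eq: "f' x = frechet_derivative f (at x)" if "x \<in> S" for x
    using assms(2)[OF that] by (rule frechet_derivative_at)
  have "Ck_on n S (\<lambda>x. frechet_derivative f (at x) h)" for h
    by (rule Ck_on_cong[OF assms(1) _ assms(3)[of h]]) (simp add: eq)
  with assms(2) show ?thesis by (auto simp: differentiable_def)
qed

lemma Ck_on_const [simp, intro]: "open S \<Longrightarrow> Ck_on n S (\<lambda>x. c)"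
proof (induction n arbitrary: c)
  case (Suc n)
  show ?case by (rule Ck_on_SucI[where f'="\<lambda>x h. 0"]) (use Suc in auto)
qed simp

lemma Ck_on_linear: 
  assumes "bounded_linear T" "open S" shows "Ck_on n S T"
proof (cases n)
  case 0
  then show ?thesis using assms by (simp add: linear_continuous_on)
next
  case (Suc m)
  show ?thesis unfolding Suc
    by (rule Ck_on_SucI[where f'="\<lambda>x. T"]) (use assms bounded_linear_imp_has_derivative in auto)
qed

lemma Ck_on_id: "open S \<Longrightarrow> Ck_on n S (\<lambda>x. x)"
  by (rule Ck_on_linear[OF bounded_linear_ident])

lemma Ck_on_add:
  assumes "open S" "Ck_on n S f" "Ck_on n S g" shows "Ck_on n S (\<lambda>x. f x + g x)"
  using assms(2,3)
proof (induction n arbitrary: f g)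
  case 0
  then show ?case by (auto intro: continuous_intros)
next
  case (Suc n)
  show ?case
    by (rule Ck_on_SucI[OF assms(1) has_derivative_add[OF Suc.prems[THEN Ck_on_has_derivative]]])
      (use Suc.prems Suc.IH in auto)
qed


text \<open>The Leibniz rule produces two terms of the same bilinear shape, so one induction covers
  products, scalar multiples and inner products at once.\<close>

lemma Ck_on_bilinear:
  fixes f :: "'e::euclidean_space \<Rightarrow> 'a::euclidean_space" and g :: "'e \<Rightarrow> 'b::euclidean_space"
    and prod :: "'a \<Rightarrow> 'b \<Rightarrow> 'c::euclidean_space"
  assumes "bounded_bilinear prod" "open S" "Ck_on n S f" "Ck_on n S g"
  shows "Ck_on n S (\<lambda>x. prod (f x) (g x))"
  using assms(3,4)
proof (induction n arbitrary: f g)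
  case 0
  then show ?case using assms(1) by (auto intro: bounded_bilinear.continuous_on)
next
  case (Suc n)
  have *: "Ck_on n S f" "Ck_on n S g" using Suc.prems Ck_on_SucD by auto
  show ?case
    by (rule Ck_on_SucI[OF assms(2) bounded_bilinear.FDERIV[OF assms(1) Suc.prems[THEN Ck_on_has_derivative]]])
      (use Suc.prems Suc.IH * assms(2) in \<open>auto intro!: Ck_on_add\<close>)
qed

lemmas Ck_on_scaleR = Ck_on_bilinear[OF bounded_bilinear_scaleR]
lemmas Ck_on_mult = Ck_on_bilinear[OF bounded_bilinear_mult[where 'a=real]]
lemmas Ck_on_inner = Ck_on_bilinear[OF bounded_bilinear_inner]

lemma Ck_on_sum:
  assumes "open S" "\<And>i. i \<in> I \<Longrightarrow> Ck_on n S (f i)"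
  shows "Ck_on n S (\<lambda>x. \<Sum>i\<in>I. f i x)"
  using assms by (induction I rule: infinite_finite_induct) (auto intro: Ck_on_add)

lemma Ck_on_linear_compose:
  fixes T :: "'b::euclidean_space \<Rightarrow> 'c::euclidean_space"
  assumes "bounded_linear T" "open S" "Ck_on n S f"
  shows "Ck_on n S (\<lambda>x. T (f x))"
  using assms(3)
proof (induction n arbitrary: f)
  case 0
  then show ?case using assms(1) by (auto intro: bounded_linear.continuous_on)
next
  case (Suc n)
  show ?case
    by (rule Ck_on_SucI[OF assms(2) bounded_linear.has_derivative[OF assms(1) Ck_on_has_derivative[OF Suc.prems]]])
      (use Suc.prems Suc.IH in auto)
qed

lemmas Ck_on_fst = Ck_on_linear_compose[OF bounded_linear_fst]
lemmas Ck_on_snd = Ck_on_linear_compose[OF bounded_linear_snd]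

lemma Ck_on_Pair:
  assumes "open S" "Ck_on n S f" "Ck_on n S g"
  shows "Ck_on n S (\<lambda>x. (f x, g x))"
proof -
  have "bounded_linear (\<lambda>a::'b. (a, 0::'c))" "bounded_linear (\<lambda>b::'c. (0::'b, b))"
    by (auto intro: bounded_linear_intros)
  from Ck_on_add[OF assms(1) Ck_on_linear_compose[OF this(1) assms(1,2)]
      Ck_on_linear_compose[OF this(2) assms(1,3)]]
  show ?thesis by simp
qed

lemma Ck_on_minus: "open S \<Longrightarrow> Ck_on n S f \<Longrightarrow> Ck_on n S (\<lambda>x. - f x)"
  by (rule Ck_on_linear_compose[OF bounded_linear_minus[OF bounded_linear_ident]])

lemma Ck_on_diff: "open S \<Longrightarrow> Ck_on n S f \<Longrightarrow> Ck_on n S g \<Longrightarrow> Ck_on n S (\<lambda>x. f x - g x)"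
  using Ck_on_add[of S n f "\<lambda>x. - g x"] Ck_on_minus by force

lemma Ck_on_power:
  fixes f :: "'a::euclidean_space \<Rightarrow> real"
  shows "open S \<Longrightarrow> Ck_on n S f \<Longrightarrow> Ck_on n S (\<lambda>x. f x ^ m)"
  by (induction m) (auto intro: Ck_on_mult)

lemma linear_eq_sum_Basis:
  fixes L :: "'a::euclidean_space \<Rightarrow> 'b::real_vector"
  assumes "linear L" shows "L h = (\<Sum>b\<in>Basis. (h \<bullet> b) *\<^sub>R L b)"
proof -
  have "L h = L (\<Sum>b\<in>Basis. (h \<bullet> b) *\<^sub>R b)" by (simp add: euclidean_representation)
  also have "\<dots> = (\<Sum>b\<in>Basis. (h \<bullet> b) *\<^sub>R L b)"
    using assms by (simp add: linear_sum linear_cmul)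
  finally show ?thesis .
qed

text \<open>Expanding \<open>k x\<close> in the basis reduces the claim to finitely many fixed
  directions. It is needed wherever a derivative is applied to a vector that itself varies with x,
  as in the chain rule.\<close>

lemma Ck_on_apply_linear:
  fixes L :: "'e::euclidean_space \<Rightarrow> 'a::euclidean_space \<Rightarrow> 'b::euclidean_space"
  assumes "open S" "\<And>x. x \<in> S \<Longrightarrow> linear (L x)" "\<And>b. b \<in> Basis \<Longrightarrow> Ck_on n S (\<lambda>x. L x b)"
    "Ck_on n S k"
  shows "Ck_on n S (\<lambda>x. L x (k x))"
proof -
  have "Ck_on n S (\<lambda>x. \<Sum>b\<in>Basis. (k x \<bullet> b) *\<^sub>R L x b)"
    by (intro Ck_on_sum Ck_on_scaleR Ck_on_inner assms Ck_on_const)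
  then show ?thesis
    by (rule Ck_on_cong[OF assms(1), rotated]) (simp add: linear_eq_sum_Basis[OF assms(2)])
qed

text \<open>Restricting to axis directions matters later: only these are eigenvectors of all
  dilations, so only for them does the derivative solve an equation of the original type.\<close>

lemma Ck_on_SucI_Basis:
  assumes "open S" "\<And>x. x \<in> S \<Longrightarrow> (f has_derivative f' x) (at x)"
    "\<And>b. b \<in> Basis \<Longrightarrow> Ck_on n S (\<lambda>x. f' x b)"
  shows "Ck_on (Suc n) S f"
proof (rule Ck_on_SucI[OF assms(1,2)])
  show "Ck_on n S (\<lambda>x. f' x h)" for h
    by (rule Ck_on_apply_linear[where L=f' and k="\<lambda>x. h"])
      (use assms has_derivative_linear[OF assms(2)] in auto)
qed

text \<open>The induction varies f and keeps g: the chain rule calls for the directional derivatives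
  of f along the same g, combined with the derivative of g by
  \<open>Ck_on_apply_linear\<close>.\<close>

lemma Ck_on_compose:
  fixes f :: "'b::euclidean_space \<Rightarrow> 'c::euclidean_space" and g :: "'a::euclidean_space \<Rightarrow> 'b"
  assumes "open S" "open T" "g ` S \<subseteq> T" "Ck_on n T f" "Ck_on n S g"
  shows "Ck_on n S (\<lambda>x. f (g x))"
  using assms(4,5)
proof (induction n arbitrary: f)
  case 0
  then show ?case using assms(3) by (auto intro: continuous_on_compose2)
next
  case (Suc n)
  have gT: "g x \<in> T" if "x \<in> S" for x using assms(3) that by auto
  show ?case
  proof (rule Ck_on_SucI[OF assms(1)])
    show "((\<lambda>x. f (g x)) has_derivative
        (\<lambda>h. frechet_derivative f (at (g x)) (frechet_derivative g (at x) h))) (at x)" if "x \<in> S" for x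
      by (rule has_derivative_compose[OF Ck_on_has_derivative[OF Suc.prems(2) that]
            Ck_on_has_derivative[OF Suc.prems(1) gT[OF that]]])
    show "Ck_on n S (\<lambda>x. frechet_derivative f (at (g x)) (frechet_derivative g (at x) h))" for h
    proof (rule Ck_on_apply_linear[OF assms(1), where L="\<lambda>x. frechet_derivative f (at (g x))"])
      show "linear (frechet_derivative f (at (g x)))" if "x \<in> S" for x
        using Ck_on_has_derivative[OF Suc.prems(1) gT[OF that]] has_derivative_linear by blast
      show "Ck_on n S (\<lambda>x. frechet_derivative f (at (g x)) b)" for b
        by (rule Suc.IH) (use Suc.prems Ck_on_SucD in auto)
    qed (use Suc.prems in auto)
  qed
qed

lemma Ck_on_exp_UNIV: "Ck_on n UNIV (exp :: real \<Rightarrow> real)"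
proof (induction n)
  case 0
  then show ?case by (auto intro: continuous_intros)
next
  case (Suc n)
  show ?case
    by (rule Ck_on_SucI[where f'="\<lambda>x h. h * exp x"])
      (auto intro!: Ck_on_mult Suc derivative_eq_intros)
qed

lemma Ck_on_exp:
  fixes f :: "'a::euclidean_space \<Rightarrow> real"
  shows "open S \<Longrightarrow> Ck_on n S f \<Longrightarrow> Ck_on n S (\<lambda>x. exp (f x))"
  by (rule Ck_on_compose[OF _ _ _ Ck_on_exp_UNIV]) auto

lemma Ck_on_inverse_nonzero: "Ck_on n (-{0}) (inverse :: real \<Rightarrow> real)"
proof (induction n)
  case 0
  then show ?case by (auto intro!: continuous_intros)
next
  case (Suc n)
  show ?case
    \<comment> \<open>Written as a polynomial in \<open>inverse x\<close> and h, the derivative is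
      covered by the induction hypothesis.\<close>
    by (rule Ck_on_SucI[where f'="\<lambda>x h. - (inverse x * h * inverse x)"])
      (auto intro!: Ck_on_minus Ck_on_mult Suc derivative_eq_intros)
qed

lemma Ck_on_divide:
  fixes f g :: "'a::euclidean_space \<Rightarrow> real"
  assumes "open S" "Ck_on n S f" "Ck_on n S g" "\<And>x. x \<in> S \<Longrightarrow> g x \<noteq> 0"
  shows "Ck_on n S (\<lambda>x. f x / g x)"
  unfolding divide_inverse
  by (intro Ck_on_mult Ck_on_compose[OF _ _ _ Ck_on_inverse_nonzero]) (use assms in auto)

lemma smooth_on_frechet_derivative:
  "smooth_on S f \<Longrightarrow> smooth_on S (\<lambda>x. frechet_derivative f (at x) h)"
  unfolding smooth_on_def by (metis Ck_on.simps(2))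

lemmas Ck_on_intros = Ck_on_const Ck_on_id Ck_on_add Ck_on_diff Ck_on_minus Ck_on_mult Ck_on_scaleR Ck_on_inner
  Ck_on_sum Ck_on_fst Ck_on_snd Ck_on_Pair Ck_on_power Ck_on_exp

subsection \<open>Integrals along anisotropic dilations\<close>

lemma continuous_on_apply_linear:
  fixes L :: "'d::topological_space \<Rightarrow> 'a::euclidean_space \<Rightarrow> 'b::real_normed_vector"
  assumes "\<And>x. x \<in> S \<Longrightarrow> linear (L x)" "\<And>h. continuous_on S (\<lambda>x. L x h)"
    "continuous_on S k"
  shows "continuous_on S (\<lambda>x. L x (k x))"
proof -
  have "continuous_on S (\<lambda>x. \<Sum>b\<in>Basis. (k x \<bullet> b) *\<^sub>R L x b)"
    by (intro continuous_intros assms)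
  then show ?thesis
    by (rule continuous_on_eq) (simp add: linear_eq_sum_Basis[OF assms(1), symmetric])
qed

lemma continuous_on_compact_norm_bound:
  fixes f :: "'a::topological_space \<Rightarrow> 'b::real_normed_vector"
  assumes "compact K" "continuous_on K f"
  obtains B where "0 \<le> B" "\<And>x. x \<in> K \<Longrightarrow> norm (f x) \<le> B"
proof -
  have "bounded (f ` K)" by (intro compact_imp_bounded compact_continuous_image assms)
  then obtain B where "\<And>x. x \<in> K \<Longrightarrow> norm (f x) \<le> B" unfolding bounded_iff by blast
  then show thesis using that[of "max B 0"] by fastforce
qed

text \<open>In finite dimension, continuity of \<open>L z h\<close> for each fixed h already gives
  continuity in the operator norm, and the norm is then bounded on the compact set.\<close>

lemma linear_family_compact_bound:
  fixes L :: "'d::t2_space \<Rightarrow> 'a::euclidean_space \<Rightarrow> 'b::real_normed_vector"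
  assumes "compact K" and lin: "\<And>z. z \<in> K \<Longrightarrow> bounded_linear (L z)"
    and cont: "\<And>h. continuous_on K (\<lambda>z. L z h)"
  shows "\<exists>C\<ge>0. \<forall>z\<in>K. \<forall>h. norm (L z h) \<le> C * norm h"
proof -
  have eq: "blinfun_apply (Blinfun (L z)) h = L z h" if "z \<in> K" for z h
    using lin[OF that] by (simp add: bounded_linear_Blinfun_apply)
  have "continuous_on K (\<lambda>z. Blinfun (L z))"
    by (rule continuous_on_blinfun_componentwise, rule continuous_on_eq[OF cont], rule eq[symmetric])
  then obtain C where C: "0 \<le> C" "\<And>z. z \<in> K \<Longrightarrow> norm (Blinfun (L z)) \<le> C"
    by (rule continuous_on_compact_norm_bound[OF \<open>compact K\<close>]) blast
  have "norm (L z h) \<le> C * norm h" if "z \<in> K" for z h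
    using norm_blinfun[of "Blinfun (L z)" h] mult_right_mono[OF C(2)[OF that] norm_ge_zero[of h]]
    by (simp add: eq[OF that])
  with C(1) show ?thesis by blast
qed

lemma Ck_on_compact_bound:
  fixes f :: "'a::euclidean_space \<Rightarrow> 'b::euclidean_space"
  assumes "compact K" "K \<subseteq> S" and f: "Ck_on (Suc 0) S f"
  shows "\<exists>C\<ge>0. \<forall>z\<in>K. norm (f z) \<le> C \<and> (\<forall>h. norm (frechet_derivative f (at z) h) \<le> C * norm h)"
proof -
  have "continuous_on K f"
    by (rule continuous_on_subset[OF Ck_on_imp_continuous_on[OF f] \<open>K \<subseteq> S\<close>])
  then obtain C1 where C1: "0 \<le> C1" "\<And>z. z \<in> K \<Longrightarrow> norm (f z) \<le> C1"
    by (rule continuous_on_compact_norm_bound[OF \<open>compact K\<close>]) blast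
  have "continuous_on S (\<lambda>z. frechet_derivative f (at z) h)" for h
    using f by simp
  then have cont: "continuous_on K (\<lambda>z. frechet_derivative f (at z) h)" for h
    using \<open>K \<subseteq> S\<close> by (rule continuous_on_subset)
  have lin: "bounded_linear (frechet_derivative f (at z))" if "z \<in> K" for z
    by (rule has_derivative_bounded_linear[OF Ck_on_has_derivative[OF f]]) (use that \<open>K \<subseteq> S\<close> in blast)
  have "\<exists>C\<ge>0. \<forall>z\<in>K. \<forall>h. norm (frechet_derivative f (at z) h) \<le> C * norm h"
    by (rule linear_family_compact_bound[OF \<open>compact K\<close> lin cont])
  then obtain C2 where C2: "0 \<le> C2" "\<And>z h. z \<in> K \<Longrightarrow> norm (frechet_derivative f (at z) h) \<le> C2 * norm h"
    by blast
  have "norm (f z) \<le> C1 + C2" if "z \<in> K" for z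
    using C1(2)[OF that] C2(1) by simp
  moreover have "norm (frechet_derivative f (at z) h) \<le> (C1 + C2) * norm h" if "z \<in> K" for z h
    using C2(2)[OF that, of h] C1(1) mult_right_mono[of C2 "C1 + C2" "norm h"] by simp
  moreover have "0 \<le> C1 + C2" using C1(1) C2(1) by simp
  ultimately show ?thesis by blast
qed

text \<open>The Leibniz rule of the library asks for derivatives that are continuous in operator
  norm. Passing through \<open>Blinfun\<close> trades this for continuity in each direction, the
  form in which \<open>Ck_on\<close> speaks of derivatives.\<close>

lemma has_derivative_integral_param:
  fixes G :: "real \<Rightarrow> 'e::euclidean_space \<Rightarrow> 'v::euclidean_space"
  assumes S: "open S" "convex S"
    and dG: "\<And>s x. s \<in> {0..1} \<Longrightarrow> x \<in> S \<Longrightarrow> (G s has_derivative G' s x) (at x)"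
    and cG: "continuous_on (S \<times> {0..1}) (\<lambda>z. G (snd z) (fst z))"
    and cG': "\<And>h. continuous_on (S \<times> {0..1}) (\<lambda>z. G' (snd z) (fst z) h)"
  shows "x \<in> S \<Longrightarrow> ((\<lambda>x. integral {0..1} (\<lambda>s. G s x)) has_derivative
          (\<lambda>h. integral {0..1} (\<lambda>s. G' s x h))) (at x)"
    and "continuous_on S (\<lambda>x. integral {0..1} (\<lambda>s. G' s x h))"
proof -
  have bl: "bounded_linear (G' s x)" if "s \<in> {0..1}" "x \<in> S" for s x
    using dG[OF that] by (rule has_derivative_bounded_linear)
  have cB: "continuous_on (S \<times> {0..1}) (\<lambda>z. Blinfun (G' (snd z) (fst z)))"
  proof (rule continuous_on_blinfun_componentwise)
    fix i
    show "continuous_on (S \<times> {0..1}) (\<lambda>z. blinfun_apply (Blinfun (G' (snd z) (fst z))) i)"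
      by (rule continuous_on_eq[OF cG'[of i]]) (auto simp: bounded_linear_Blinfun_apply bl)
  qed
  have slice: "continuous_on {0..1} (\<lambda>s. H (x, s))" if "continuous_on (S \<times> {0..1}) H" "x \<in> S"
    for H :: "'e \<times> real \<Rightarrow> 'x::topological_space" and x
    by (rule continuous_on_compose2[OF that(1)]) (use that in \<open>auto intro!: continuous_intros\<close>)
  show "continuous_on S (\<lambda>x. integral {0..1} (\<lambda>s. G' s x h))"
    using integral_continuous_on_param[of S 0 1 "\<lambda>x s. G' s x h"] cG'[of h]
    by (simp add: split_beta)
  assume x: "x \<in> S"
  have "((\<lambda>x. integral (cbox 0 1) (\<lambda>s. G s x)) has_derivative
          blinfun_apply (integral (cbox 0 1) (\<lambda>s. Blinfun (G' s x)))) (at x within S)"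
  proof (rule leibniz_rule[OF _ _ _ x \<open>convex S\<close>])
    show "((\<lambda>x. G t x) has_derivative blinfun_apply (Blinfun (G' t y))) (at y within S)"
      if "y \<in> S" "t \<in> cbox 0 1" for y t
      using dG[of t y] that bl[of t y] has_derivative_at_withinI
      by (auto simp: bounded_linear_Blinfun_apply)
    show "(\<lambda>s. G s y) integrable_on cbox 0 1" if "y \<in> S" for y
      using slice[OF cG that] by (simp add: integrable_continuous_interval)
    show "continuous_on (S \<times> cbox 0 1) (\<lambda>(x, t). Blinfun (G' t x))"
      using cB by (simp add: split_beta)
  qed
  moreover have "blinfun_apply (integral (cbox 0 1) (\<lambda>s. Blinfun (G' s x))) h
      = integral {0..1} (\<lambda>s. G' s x h)" for h
  proof -
    have "(\<lambda>s. Blinfun (G' s x)) integrable_on cbox 0 1"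
      using slice[OF cB x] by (simp add: integrable_continuous_interval)
    then have "blinfun_apply (integral (cbox 0 1) (\<lambda>s. Blinfun (G' s x))) h
      = integral (cbox 0 1) (\<lambda>s. blinfun_apply (Blinfun (G' s x)) h)"
      by (rule blinfun_apply_integral)
    also have "\<dots> = integral {0..1} (\<lambda>s. G' s x h)"
      unfolding cbox_interval by (rule integral_cong) (simp add: bounded_linear_Blinfun_apply bl x)
    finally show ?thesis .
  qed
  then have "blinfun_apply (integral (cbox 0 1) (\<lambda>s. Blinfun (G' s x)))
      = (\<lambda>h. integral {0..1} (\<lambda>s. G' s x h))" by (rule ext)
  ultimately have "((\<lambda>x. integral {0..1} (\<lambda>s. G s x)) has_derivative
          (\<lambda>h. integral {0..1} (\<lambda>s. G' s x h))) (at x within S)"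
    unfolding cbox_interval by (rule has_derivative_eq_rhs)
  then show "((\<lambda>x. integral {0..1} (\<lambda>s. G s x)) has_derivative
          (\<lambda>h. integral {0..1} (\<lambda>s. G' s x h))) (at x)"
    unfolding at_within_open[OF x S(1)] .
qed

lemma norm_integral_unit_le:
  fixes f :: "real \<Rightarrow> 'a::banach"
  assumes "continuous_on {0..1} f" "\<And>t. t \<in> {0..1} \<Longrightarrow> norm (f t) \<le> B"
  shows "norm (integral {0..1} f) \<le> B"
  using integral_bound[of 0 1 f B] assms by simp

text \<open>The map is diagonal with weight \<open>c b s\<close> on the axis b. The bound by 1 on
  the weights keeps every ball invariant and prevents the contraction constant from growing when an
  equation is differentiated along an axis.\<close>

locale dilation =
  fixes c :: "'e::euclidean_space \<Rightarrow> real \<Rightarrow> real"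
  assumes smooth_c: "b \<in> Basis \<Longrightarrow> smooth_on UNIV (c b)"
    and c_le: "b \<in> Basis \<Longrightarrow> s \<in> {0..1} \<Longrightarrow> \<bar>c b s\<bar> \<le> 1"
begin

definition dil :: "real \<Rightarrow> 'e \<Rightarrow> 'e" where
  "dil s x = (\<Sum>b\<in>Basis. (c b s * (x \<bullet> b)) *\<^sub>R b)"

lemma bounded_linear_dil: "bounded_linear (dil s)"
  unfolding dil_def
  by (intro bounded_linear_sum bounded_linear_scaleR_const bounded_linear_const_mult bounded_linear_inner_left)

lemma dil_inner: "b \<in> Basis \<Longrightarrow> dil s x \<bullet> b = c b s * (x \<bullet> b)"
  unfolding dil_def by simp

lemma dil_Basis: "b \<in> Basis \<Longrightarrow> dil s b = c b s *\<^sub>R b"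
  by (rule euclidean_eqI) (simp add: dil_inner inner_Basis)

lemma norm_dil_le:
  assumes "s \<in> {0..1}" shows "norm (dil s x) \<le> norm x"
proof (rule norm_le_componentwise)
  fix b :: 'e assume "b \<in> Basis"
  then show "\<bar>dil s x \<bullet> b\<bar> \<le> \<bar>x \<bullet> b\<bar>"
    using c_le[of b s] assms by (simp add: dil_inner abs_mult mult_left_le_one_le)
qed

lemma dil_in_ball: "s \<in> {0..1} \<Longrightarrow> x \<in> ball 0 r \<Longrightarrow> dil s x \<in> ball 0 r"
  using norm_dil_le[of s x] by simp

lemma Ck_on_c:
  assumes "open \<Theta>" "b \<in> Basis"
  shows "Ck_on n \<Theta> (\<lambda>z. c b (fst z))"
proof (rule Ck_on_compose[where f="c b" and g=fst, OF assms(1) open_UNIV])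
  show "Ck_on n UNIV (c b)" using smooth_c[OF assms(2)] by (simp add: smooth_on_def)
qed (auto intro: Ck_on_linear bounded_linear_fst assms)

lemma Ck_on_dil: "Ck_on n UNIV (\<lambda>z. dil (fst z) (snd z))"
  unfolding dil_def by (intro Ck_on_intros Ck_on_c) (rule open_UNIV | assumption)+

lemma continuous_on_dil [continuous_intros]:
  "continuous_on S f \<Longrightarrow> continuous_on S g \<Longrightarrow> continuous_on S (\<lambda>x. dil (f x) (g x))"
  using continuous_on_compose2[OF Ck_on_imp_continuous_on[OF Ck_on_dil] continuous_on_Pair, of S f g]
  by simp

lemma integral_dil_continuous:
  assumes "continuous_on \<Omega> F" "continuous_on (ball 0 r) w"
    and "\<And>s x. s \<in> {0..1} \<Longrightarrow> x \<in> ball 0 r \<Longrightarrow> (s, x, w (dil s x)) \<in> \<Omega>"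
  shows "continuous_on (ball 0 r \<times> {0..1}) (\<lambda>z. F (snd z, fst z, w (dil (snd z) (fst z))))"
    and "x \<in> ball 0 r \<Longrightarrow> continuous_on {0..1} (\<lambda>s. F (s, x, w (dil s x)))"
proof -
  show *: "continuous_on (ball 0 r \<times> {0..1}) (\<lambda>z. F (snd z, fst z, w (dil (snd z) (fst z))))"
  proof (rule continuous_on_compose2[OF assms(1)])
    have "continuous_on (ball 0 r \<times> {0..1}) (\<lambda>z. dil (snd z) (fst z))"
      by (intro continuous_on_dil continuous_on_snd continuous_on_fst continuous_on_id)
    then have "continuous_on (ball 0 r \<times> {0..1}) (\<lambda>z. w (dil (snd z) (fst z)))"
      by (rule continuous_on_compose2[OF assms(2)]) (use dil_in_ball in auto)
    then show "continuous_on (ball 0 r \<times> {0..1}) (\<lambda>z. (snd z, fst z, w (dil (snd z) (fst z))))"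
      by (intro continuous_on_Pair continuous_on_snd continuous_on_fst continuous_on_id)
  qed (use assms(3) in auto)
  have "continuous_on {0..1} (\<lambda>s::real. (x, s))"
    by (intro continuous_intros)
  from continuous_on_compose2[OF * this]
  show "continuous_on {0..1} (\<lambda>s. F (s, x, w (dil s x)))" if "x \<in> ball 0 r"
    using that by (simp add: image_subset_iff)
qed

text \<open>Since \<open>dil s\<close> is linear, a variation h of x reaches w as
  \<open>dil s h\<close>; the leading 0 in the direction says that s is held fixed under the
  integral.\<close>

lemma has_derivative_integral_dil:
  fixes F :: "real \<times> 'e \<times> 'v::euclidean_space \<Rightarrow> 'w::euclidean_space"
  assumes dF: "\<And>z. z \<in> \<Omega> \<Longrightarrow> (F has_derivative F' z) (at z)"
    and cF': "\<And>h. continuous_on \<Omega> (\<lambda>z. F' z h)"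
    and dw: "\<And>x. x \<in> ball 0 r \<Longrightarrow> (w has_derivative w' x) (at x)"
    and cw': "\<And>h. continuous_on (ball 0 r) (\<lambda>x. w' x h)"
    and in_dom: "\<And>s x. s \<in> {0..1} \<Longrightarrow> x \<in> ball 0 r \<Longrightarrow> (s, x, w (dil s x)) \<in> \<Omega>"
  shows "x \<in> ball 0 r \<Longrightarrow> ((\<lambda>x. integral {0..1} (\<lambda>s. F (s, x, w (dil s x)))) has_derivative
          (\<lambda>h. integral {0..1} (\<lambda>s. F' (s, x, w (dil s x)) (0, h, w' (dil s x) (dil s h))))) (at x)"
    and "continuous_on (ball 0 r)
          (\<lambda>x. integral {0..1} (\<lambda>s. F' (s, x, w (dil s x)) (0, h, w' (dil s x) (dil s h))))"
    and "x \<in> ball 0 r \<Longrightarrow>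
          continuous_on {0..1} (\<lambda>s. F' (s, x, w (dil s x)) (0, h, w' (dil s x) (dil s h)))"
proof -
  have cF: "continuous_on \<Omega> F"
    by (intro continuous_at_imp_continuous_on ballI has_derivative_continuous[OF dF])
  have cw: "continuous_on (ball 0 r) w"
    by (intro continuous_at_imp_continuous_on ballI has_derivative_continuous[OF dw])
  have c1: "continuous_on (ball 0 r \<times> {0..1}) (\<lambda>z. w' (dil (snd z) (fst z)) (dil (snd z) h))" for h
  proof (rule continuous_on_apply_linear[where L="\<lambda>z. w' (dil (snd z) (fst z))"])
    show "linear (w' (dil (snd z) (fst z)))" if "z \<in> ball 0 r \<times> {0..1}" for z
    proof -
      have "dil (snd z) (fst z) \<in> ball 0 r" using that by (intro dil_in_ball) auto
      then show ?thesis by (rule has_derivative_linear[OF dw])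
    qed
    show "continuous_on (ball 0 r \<times> {0..1}) (\<lambda>z. w' (dil (snd z) (fst z)) k)" for k
    proof (rule continuous_on_compose2[OF cw'])
      show "continuous_on (ball 0 r \<times> {0..1}) (\<lambda>z. dil (snd z) (fst z))"
        by (intro continuous_on_dil continuous_on_snd continuous_on_fst continuous_on_id)
    qed (use dil_in_ball in auto)
  qed (intro continuous_on_dil continuous_on_snd continuous_on_id continuous_on_const)
  have c2: "continuous_on (ball 0 r \<times> {0..1}) (\<lambda>z. F' (snd z, fst z, w (dil (snd z) (fst z)))
        (0, h, w' (dil (snd z) (fst z)) (dil (snd z) h)))" for h
  proof (rule continuous_on_apply_linear[where L="\<lambda>z. F' (snd z, fst z, w (dil (snd z) (fst z)))"])
    show "linear (F' (snd z, fst z, w (dil (snd z) (fst z))))" if "z \<in> ball 0 r \<times> {0..1}" for z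
    proof -
      have "(snd z, fst z, w (dil (snd z) (fst z))) \<in> \<Omega>" using that by (intro in_dom) auto
      then show ?thesis by (rule has_derivative_linear[OF dF])
    qed
    show "continuous_on (ball 0 r \<times> {0..1}) (\<lambda>z. F' (snd z, fst z, w (dil (snd z) (fst z))) k)" for k
      by (rule integral_dil_continuous(1)[OF cF' cw in_dom])
  qed (intro continuous_on_Pair continuous_on_const c1)
  have d: "((\<lambda>x. F (s, x, w (dil s x))) has_derivative
      (\<lambda>h. F' (s, x, w (dil s x)) (0, h, w' (dil s x) (dil s h)))) (at x)"
    if "s \<in> {0..1}" "x \<in> ball 0 r" for s x
  proof -
    have "((\<lambda>x. (s, x, w (dil s x))) has_derivative (\<lambda>h. (0, h, w' (dil s x) (dil s h)))) (at x)"
      using has_derivative_compose[OF bounded_linear_imp_has_derivative[OF bounded_linear_dil]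
          dw[OF dil_in_ball[OF that]]]
      by (intro has_derivative_Pair has_derivative_const has_derivative_ident)
    from has_derivative_compose[OF this dF[OF in_dom[OF that]]] show ?thesis .
  qed
  note * = has_derivative_integral_param[where S="ball 0 r" and G="\<lambda>s x. F (s, x, w (dil s x))"
      and G'="\<lambda>s x h. F' (s, x, w (dil s x)) (0, h, w' (dil s x) (dil s h))",
      OF open_ball convex_ball d integral_dil_continuous(1)[OF cF cw in_dom] c2]
  show "x \<in> ball 0 r \<Longrightarrow> ((\<lambda>x. integral {0..1} (\<lambda>s. F (s, x, w (dil s x)))) has_derivative
          (\<lambda>h. integral {0..1} (\<lambda>s. F' (s, x, w (dil s x)) (0, h, w' (dil s x) (dil s h))))) (at x)"
    using *(1) .
  show "continuous_on (ball 0 r)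
          (\<lambda>x. integral {0..1} (\<lambda>s. F' (s, x, w (dil s x)) (0, h, w' (dil s x) (dil s h))))"
    using *(2) .
  have "continuous_on {0..1} (\<lambda>s::real. (x, s))"
    by (intro continuous_intros)
  from continuous_on_compose2[OF c2[of h] this]
  show "x \<in> ball 0 r \<Longrightarrow>
          continuous_on {0..1} (\<lambda>s. F' (s, x, w (dil s x)) (0, h, w' (dil s x) (dil s h)))"
    by (simp add: image_subset_iff)
qed

end

subsection \<open>Picard iteration for the dilation equation\<close>

text \<open>\<open>F_le\<close> makes the closed ball of radius \<open>\<rho>\<close> invariant, and
  \<open>F_contraction\<close> asks for smallness only in the unknown: the derivative in x merely
  contributes an inhomogeneous term. The closed balls in \<open>dom\<close> provide the compactness
  behind uniform bounds on \<open>F'\<close>.\<close>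

locale picard = dilation c for c :: "'e::euclidean_space \<Rightarrow> real \<Rightarrow> real" +
  fixes F :: "real \<times> 'e \<times> 'v::euclidean_space \<Rightarrow> 'v"
    and F' :: "real \<times> 'e \<times> 'v \<Rightarrow> real \<times> 'e \<times> 'v \<Rightarrow> 'v"
    and \<Omega> :: "(real \<times> 'e \<times> 'v) set" and r \<rho> :: real
  assumes dF: "z \<in> \<Omega> \<Longrightarrow> (F has_derivative F' z) (at z)"
    and cF': "continuous_on \<Omega> (\<lambda>z. F' z h)"
    and dom: "{0..1} \<times> cball 0 r \<times> cball 0 \<rho> \<subseteq> \<Omega>"
    and r_pos: "0 < r" and rho_nonneg: "0 \<le> \<rho>"
    and F_le: "s \<in> {0..1} \<Longrightarrow> x \<in> ball 0 r \<Longrightarrow> a \<in> cball 0 \<rho> \<Longrightarrow> norm (F (s, x, a)) \<le> \<rho>"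
    and F_contraction: "s \<in> {0..1} \<Longrightarrow> x \<in> ball 0 r \<Longrightarrow> a \<in> cball 0 \<rho> \<Longrightarrow>
      norm (F' (s, x, a) (0, 0, m)) \<le> norm m / 2"
begin

lemma in_dom: "s \<in> {0..1} \<Longrightarrow> x \<in> ball 0 r \<Longrightarrow> a \<in> cball 0 \<rho> \<Longrightarrow> (s, x, a) \<in> \<Omega>"
  using dom by (auto simp: subset_iff)

lemma continuous_on_F: "continuous_on \<Omega> F"
  by (intro continuous_at_imp_continuous_on ballI has_derivative_continuous[OF dF])

lemma F_lipschitz:
  assumes "s \<in> {0..1}" "x \<in> ball 0 r" "a \<in> cball 0 \<rho>" "b \<in> cball 0 \<rho>"
  shows "norm (F (s, x, a) - F (s, x, b)) \<le> norm (a - b) / 2"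
proof -
  have "norm (F (s, x, a) - F (s, x, b)) \<le> (1/2) * norm (a - b)"
  proof (rule differentiable_bound[OF convex_cball _ _ assms(3,4)])
    fix y :: 'v assume y: "y \<in> cball 0 \<rho>"
    have "((\<lambda>y. (s, x, y)) has_derivative (\<lambda>m. (0, 0, m))) (at y)"
      by (intro has_derivative_Pair has_derivative_const has_derivative_ident)
    from has_derivative_compose[OF this dF[OF in_dom[OF assms(1,2) y]]]
    show "((\<lambda>y. F (s, x, y)) has_derivative (\<lambda>m. F' (s, x, y) (0, 0, m))) (at y within cball 0 \<rho>)"
      by (rule has_derivative_at_withinI)
    show "onorm (\<lambda>m. F' (s, x, y) (0, 0, m)) \<le> 1/2"
      by (rule onorm_le) (use F_contraction[OF assms(1,2) y] in simp)
  qed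
  then show ?thesis by simp
qed

lemma F'_linear: "s \<in> {0..1} \<Longrightarrow> x \<in> ball 0 r \<Longrightarrow> a \<in> cball 0 \<rho> \<Longrightarrow> linear (F' (s, x, a))"
  using in_dom dF has_derivative_linear by blast

section \<open>Uniform bounds and moduli of continuity for the derivative of F\<close>

lemma compact_dom: "compact ({0..1::real} \<times> cball (0::'e) r \<times> cball (0::'v) \<rho>)"
  by (intro compact_Times compact_Icc compact_cball)

lemma Blinfun_F':
  shows "z \<in> \<Omega> \<Longrightarrow> blinfun_apply (Blinfun (F' z)) k = F' z k"
    and "continuous_on \<Omega> (\<lambda>z. Blinfun (F' z))"
proof -
  show *: "blinfun_apply (Blinfun (F' z)) k = F' z k" if "z \<in> \<Omega>" for z k
    using has_derivative_bounded_linear[OF dF[OF that]] by (simp add: bounded_linear_Blinfun_apply)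
  show "continuous_on \<Omega> (\<lambda>z. Blinfun (F' z))"
    by (rule continuous_on_blinfun_componentwise, rule continuous_on_eq[OF cF'], rule *[symmetric])
qed

lemma F'_bound:
  obtains C where "0 \<le> C" "\<And>s x a k. s \<in> {0..1} \<Longrightarrow> x \<in> ball 0 r \<Longrightarrow> a \<in> cball 0 \<rho> \<Longrightarrow>
    norm (F' (s, x, a) k) \<le> C * norm k"
proof -
  have "bounded_linear (F' z)" if "z \<in> {0..1} \<times> cball 0 r \<times> cball 0 \<rho>" for z
    using has_derivative_bounded_linear[OF dF] dom that by blast
  then have "\<exists>C\<ge>0. \<forall>z\<in>{0..1} \<times> cball 0 r \<times> cball 0 \<rho>. \<forall>k. norm (F' z k) \<le> C * norm k"
    by (rule linear_family_compact_bound[OF compact_dom _ continuous_on_subset[OF cF' dom]])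
  then obtain C where "0 \<le> C"
    and C: "\<And>z k. z \<in> {0..1} \<times> cball 0 r \<times> cball 0 \<rho> \<Longrightarrow> norm (F' z k) \<le> C * norm k"
    by blast
  show thesis by (rule that[OF \<open>0 \<le> C\<close> C]) auto
qed

text \<open>Uniform closeness of two iterates has to make the coefficients of their differentiated
  recursions close in operator norm; Heine-Cantor on the compact domain supplies this.\<close>

lemma F'_uniformly_continuous:
  assumes "0 < e"
  obtains d where "0 < d" "\<And>s x a b k. s \<in> {0..1} \<Longrightarrow> x \<in> ball 0 r \<Longrightarrow> a \<in> cball 0 \<rho> \<Longrightarrow>
    b \<in> cball 0 \<rho> \<Longrightarrow> norm (a - b) < d \<Longrightarrow> norm (F' (s, x, a) k - F' (s, x, b) k) \<le> e * norm k"
proof -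
  have "uniformly_continuous_on ({0..1} \<times> cball 0 r \<times> cball 0 \<rho>) (\<lambda>z. Blinfun (F' z))"
    by (intro compact_uniformly_continuous compact_dom continuous_on_subset[OF Blinfun_F'(2) dom])
  then obtain d where d: "0 < d" "\<And>z z'. z \<in> {0..1} \<times> cball 0 r \<times> cball 0 \<rho> \<Longrightarrow>
      z' \<in> {0..1} \<times> cball 0 r \<times> cball 0 \<rho> \<Longrightarrow> dist z' z < d \<Longrightarrow>
      dist (Blinfun (F' z')) (Blinfun (F' z)) < e"
    using \<open>0 < e\<close> unfolding uniformly_continuous_on_def by metis
  show thesis
  proof (rule that[OF d(1)])
    fix s :: real and x :: 'e and a b :: 'v and k
    assume *: "s \<in> {0..1}" "x \<in> ball 0 r" and a: "a \<in> cball 0 \<rho>" and b: "b \<in> cball 0 \<rho>"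
      and ab: "norm (a - b) < d"
    have "norm (F' (s, x, a) k - F' (s, x, b) k)
        = norm (blinfun_apply (Blinfun (F' (s, x, a)) - Blinfun (F' (s, x, b))) k)"
      using in_dom[OF * a] in_dom[OF * b] by (simp add: Blinfun_F'(1) blinfun.diff_left)
    also have "\<dots> \<le> norm (Blinfun (F' (s, x, a)) - Blinfun (F' (s, x, b))) * norm k"
      by (rule norm_blinfun)
    also have "\<dots> \<le> e * norm k"
      using d(2)[of "(s, x, b)" "(s, x, a)"] * a b ab
      by (intro mult_right_mono) (auto simp: dist_norm)
    finally show "norm (F' (s, x, a) k - F' (s, x, b) k) \<le> e * norm k" .
  qed
qed

section \<open>Existence of a continuous fixed point\<close>

definition step :: "('e \<Rightarrow> 'v) \<Rightarrow> 'e \<Rightarrow> 'v" where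
  "step w x = integral {0..1} (\<lambda>s. F (s, x, w (dil s x)))"

definition admissible :: "('e \<Rightarrow> 'v) \<Rightarrow> bool" where
  "admissible w \<longleftrightarrow> continuous_on (ball 0 r) w \<and> w ` ball 0 r \<subseteq> cball 0 \<rho>"

lemma admissible_le: "admissible w \<Longrightarrow> x \<in> ball 0 r \<Longrightarrow> norm (w x) \<le> \<rho>"
  unfolding admissible_def by (metis image_subset_iff mem_cball_0)

lemma admissible_in_cball:
  "admissible w \<Longrightarrow> s \<in> {0..1} \<Longrightarrow> x \<in> ball 0 r \<Longrightarrow> w (dil s x) \<in> cball 0 \<rho>"
  using dil_in_ball[of s x r] unfolding admissible_def by blast

lemma admissible_in_dom:
  "admissible w \<Longrightarrow> s \<in> {0..1} \<Longrightarrow> x \<in> ball 0 r \<Longrightarrow> (s, x, w (dil s x)) \<in> \<Omega>"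
  by (intro in_dom admissible_in_cball)

lemma admissible_continuous:
  assumes "admissible w" "x \<in> ball 0 r"
  shows "continuous_on {0..1} (\<lambda>s. F (s, x, w (dil s x)))"
  using integral_dil_continuous(2)[OF continuous_on_F _ admissible_in_dom[OF assms(1)] assms(2)] assms(1)
  unfolding admissible_def by blast

lemma admissible_step:
  assumes "admissible w" shows "admissible (step w)"
  unfolding admissible_def
proof
  have "continuous_on (ball 0 r \<times> cbox 0 1) (\<lambda>z. F (snd z, fst z, w (dil (snd z) (fst z))))"
    unfolding cbox_interval
    using integral_dil_continuous(1)[OF continuous_on_F _ admissible_in_dom[OF assms]] assms
    unfolding admissible_def by blast
  then have "continuous_on (ball 0 r) (\<lambda>x. integral (cbox 0 1) (\<lambda>s. F (s, x, w (dil s x))))"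
    by (intro integral_continuous_on_param) (simp add: split_beta)
  then show "continuous_on (ball 0 r) (step w)"
    unfolding step_def cbox_interval by simp
  have "norm (step w x) \<le> \<rho>" if "x \<in> ball 0 r" for x
    unfolding step_def
    by (rule norm_integral_unit_le[OF admissible_continuous[OF assms that]])
      (intro F_le that admissible_in_cball[OF assms])
  then show "step w ` ball 0 r \<subseteq> cball 0 \<rho>" by auto
qed

lemma step_contraction:
  assumes "admissible w1" "admissible w2" "\<And>x. x \<in> ball 0 r \<Longrightarrow> norm (w1 x - w2 x) \<le> e"
    and x: "x \<in> ball 0 r"
  shows "norm (step w1 x - step w2 x) \<le> e / 2"
proof -
  note c = admissible_continuous[OF assms(1) x] admissible_continuous[OF assms(2) x]
  have "step w1 x - step w2 x
      = integral {0..1} (\<lambda>s. F (s, x, w1 (dil s x)) - F (s, x, w2 (dil s x)))"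
    unfolding step_def using c by (simp add: Henstock_Kurzweil_Integration.integral_diff integrable_continuous_interval)
  also have "norm \<dots> \<le> e / 2"
  proof (rule norm_integral_unit_le[OF continuous_on_diff[OF c]])
    fix s :: real assume s: "s \<in> {0..1}"
    have "norm (F (s, x, w1 (dil s x)) - F (s, x, w2 (dil s x))) \<le> norm (w1 (dil s x) - w2 (dil s x)) / 2"
      by (intro F_lipschitz s x admissible_in_cball assms)
    also have "\<dots> \<le> e / 2"
      using assms(3)[OF dil_in_ball[OF s x]] by simp
    finally show "norm (F (s, x, w1 (dil s x)) - F (s, x, w2 (dil s x))) \<le> e / 2" .
  qed
  finally show ?thesis .
qed

definition iter :: "nat \<Rightarrow> 'e \<Rightarrow> 'v" where
  "iter n = (step ^^ n) (\<lambda>x. 0)"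

lemma iter_0: "iter 0 = (\<lambda>x. 0)" and iter_Suc: "iter (Suc n) = step (iter n)"
  by (simp_all add: iter_def)

lemma admissible_iter: "admissible (iter n)"
proof (induction n)
  case 0
  then show ?case using rho_nonneg by (auto simp: iter_0 admissible_def)
qed (simp add: iter_Suc admissible_step)

lemma iter_le: "x \<in> ball 0 r \<Longrightarrow> norm (iter n x) \<le> \<rho>"
  by (rule admissible_le[OF admissible_iter])

text \<open>Stated for an arbitrary admissible fixed point, so that a solution known beforehand, and
  known only to be continuous, is recognized as the limit of the iterates. The bootstrapping
  argument starts from such a solution.\<close>

lemma iter_tendsto_fixpoint:
  assumes "admissible u" "\<And>x. x \<in> ball 0 r \<Longrightarrow> u x = step u x"
  shows "x \<in> ball 0 r \<Longrightarrow> norm (iter n x - u x) \<le> \<rho> / 2 ^ n"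
proof (induction n arbitrary: x)
  case 0
  then show ?case using admissible_le[OF assms(1)] by (simp add: iter_0)
next
  case (Suc n)
  then show ?case
    using step_contraction[OF admissible_iter assms(1), of n "\<rho> / 2 ^ n" x] assms(2)
    by (simp add: iter_Suc)
qed

lemma iter_diff_le: "x \<in> ball 0 r \<Longrightarrow> norm (iter (Suc n) x - iter n x) \<le> \<rho> / 2 ^ n"
proof (induction n arbitrary: x)
  case 0
  then show ?case using iter_le[of x "Suc 0"] by (simp add: iter_0)
next
  case (Suc n)
  then show ?case
    using step_contraction[OF admissible_iter admissible_iter, of "Suc n" n "\<rho> / 2 ^ n" x]
    by (simp add: iter_Suc)
qed

lemma fixpoint_exists:
  obtains u where "admissible u" "\<And>x. x \<in> ball 0 r \<Longrightarrow> u x = step u x"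
proof -
  \<comment> \<open>The iterates are the partial sums of their increments because
    \<open>iter 0\<close> is zero, so the Weierstrass M-test gives uniform convergence.\<close>
  have "summable (\<lambda>n. \<rho> * (1/2) ^ n)"
    by (intro summable_mult summable_geometric) simp
  then have "uniformly_convergent_on (ball 0 r) (\<lambda>n x. \<Sum>i<n. iter (Suc i) x - iter i x)"
    by (rule Weierstrass_m_test'[rotated]) (use iter_diff_le in \<open>auto simp: power_one_over field_simps\<close>)
  moreover have "(\<Sum>i<n. iter (Suc i) x - iter i x) = iter n x" for n x
    using sum_lessThan_telescope[of "\<lambda>i. iter i x" n] by (simp add: iter_0)
  ultimately obtain u where u: "uniform_limit (ball 0 r) iter u sequentially"
    unfolding uniformly_convergent_on_def by auto
  have cu: "continuous_on (ball 0 r) u"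
    by (rule uniform_limit_theorem[OF _ u]) (use admissible_iter in \<open>auto simp: admissible_def\<close>)
  have lim: "(\<lambda>n. iter n x) \<longlonglongrightarrow> u x" if "x \<in> ball 0 r" for x
    using tendsto_uniform_limitI[OF u that] .
  have "norm (u x) \<le> \<rho>" if "x \<in> ball 0 r" for x
    by (rule Lim_norm_ubound[OF _ lim[OF that]]) (use iter_le[OF that] in auto)
  with cu have adm: "admissible u" by (auto simp: admissible_def)
  show thesis
  proof (rule that[OF adm])
    fix x :: 'e assume x: "x \<in> ball 0 r"
    have "(\<lambda>n. iter (Suc n) x) \<longlonglongrightarrow> step u x"
    proof (rule metric_LIMSEQ_I)
      fix e :: real assume "0 < e"
      then obtain N where N: "\<And>n y. n \<ge> N \<Longrightarrow> y \<in> ball 0 r \<Longrightarrow> dist (iter n y) (u y) < e"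
        using u unfolding uniform_limit_iff eventually_sequentially by meson
      have "dist (iter (Suc n) x) (step u x) < e" if "n \<ge> N" for n
        using step_contraction[OF admissible_iter adm, of n e x] N[OF that] x \<open>0 < e\<close>
        by (fastforce simp: iter_Suc dist_norm)
      then show "\<exists>N. \<forall>n\<ge>N. dist (iter (Suc n) x) (step u x) < e" by blast
    qed
    then show "u x = step u x"
      using LIMSEQ_unique LIMSEQ_Suc[OF lim[OF x]] by blast
  qed
qed

section \<open>Convergence of the derivatives of the iterates\<close>

definition iter' :: "nat \<Rightarrow> 'e \<Rightarrow> 'e \<Rightarrow> 'v" where
  "iter' n x = frechet_derivative (iter n) (at x)"

lemma has_derivative_step:
  assumes "admissible w" "\<And>x. x \<in> ball 0 r \<Longrightarrow> (w has_derivative w' x) (at x)"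
    "\<And>h. continuous_on (ball 0 r) (\<lambda>x. w' x h)"
  shows "x \<in> ball 0 r \<Longrightarrow> (step w has_derivative
      (\<lambda>h. integral {0..1} (\<lambda>s. F' (s, x, w (dil s x)) (0, h, w' (dil s x) (dil s h))))) (at x)"
    and "continuous_on (ball 0 r)
          (\<lambda>x. integral {0..1} (\<lambda>s. F' (s, x, w (dil s x)) (0, h, w' (dil s x) (dil s h))))"
    and "x \<in> ball 0 r \<Longrightarrow>
          continuous_on {0..1} (\<lambda>s. F' (s, x, w (dil s x)) (0, h, w' (dil s x) (dil s h)))"
  unfolding step_def[abs_def]
  by (rule has_derivative_integral_dil[OF dF cF' assms(2,3) admissible_in_dom[OF assms(1)]]; assumption)+

text \<open>Both claims are carried through one induction: differentiating the next iterate under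
  the integral requires the derivative of the present one to be continuous.\<close>

lemma has_derivative_iter:
  shows "x \<in> ball 0 r \<Longrightarrow> (iter n has_derivative iter' n x) (at x)"
    and "continuous_on (ball 0 r) (\<lambda>x. iter' n x h)"
proof (induction n arbitrary: x h)
  case 0
  {
    case 1
    then show ?case by (simp add: iter_0 iter'_def)
  next
    case 2
    then show ?case by (simp add: iter_0 iter'_def)
  }
next
  case (Suc n)
  let ?D = "\<lambda>x h. integral {0..1} (\<lambda>s. F' (s, x, iter n (dil s x)) (0, h, iter' n (dil s x) (dil s h)))"
  have d: "(iter (Suc n) has_derivative ?D x) (at x)" if "x \<in> ball 0 r" for x
    unfolding iter_Suc by (rule has_derivative_step(1)[OF admissible_iter Suc.IH that])
  have c: "continuous_on (ball 0 r) (\<lambda>x. ?D x h)" for h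
    by (rule has_derivative_step(2)[OF admissible_iter Suc.IH])
  have eq: "iter' (Suc n) x = ?D x" if "x \<in> ball 0 r" for x
    unfolding iter'_def[of "Suc n"] using frechet_derivative_at[OF d[OF that]] by simp
  {
    case 1
    then show ?case using d[OF 1] eq[OF 1] by simp
  next
    case 2
    show ?case by (rule continuous_on_eq[OF c]) (simp add: eq)
  }
qed

lemma continuous_on_iter'_integrand:
  "x \<in> ball 0 r \<Longrightarrow>
    continuous_on {0..1} (\<lambda>s. F' (s, x, iter n (dil s x)) (0, h, iter' n (dil s x) (dil s h)))"
  by (rule has_derivative_step(3)[OF admissible_iter has_derivative_iter])

lemma iter'_0: "iter' 0 x = (\<lambda>h. 0)"
  by (simp add: iter_0 iter'_def)

lemma iter'_Suc:
  assumes "x \<in> ball 0 r"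
  shows "iter' (Suc n) x h =
      integral {0..1} (\<lambda>s. F' (s, x, iter n (dil s x)) (0, h, iter' n (dil s x) (dil s h)))"
proof -
  have "(step (iter n) has_derivative (\<lambda>h.
      integral {0..1} (\<lambda>s. F' (s, x, iter n (dil s x)) (0, h, iter' n (dil s x) (dil s h))))) (at x)"
    by (rule has_derivative_step(1)[OF admissible_iter has_derivative_iter assms])
  from frechet_derivative_at[OF this] show ?thesis
    unfolding iter'_def[of "Suc n"] iter_Suc by (rule fun_cong[symmetric])
qed

text \<open>The constant K = 2C solves K = C + K/2: the direction splits into
  \<open>(0, h, 0)\<close>, which costs C times the norm of h, and \<open>(0, 0, m)\<close>, which
  \<open>F_contraction\<close> halves.\<close>

lemma iter'_le:
  assumes "0 \<le> C"
    and C: "\<And>s x a k. s \<in> {0..1} \<Longrightarrow> x \<in> ball 0 r \<Longrightarrow> a \<in> cball 0 \<rho> \<Longrightarrow> norm (F' (s, x, a) k) \<le> C * norm k"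
  shows "x \<in> ball 0 r \<Longrightarrow> norm (iter' n x h) \<le> 2 * C * norm h"
proof (induction n arbitrary: x h)
  case 0
  then show ?case using \<open>0 \<le> C\<close> by (simp add: iter'_0)
next
  case (Suc n)
  note x = Suc.prems
  show ?case
    unfolding iter'_Suc[OF x]
  proof (rule norm_integral_unit_le[OF continuous_on_iter'_integrand[OF x]])
    fix s :: real assume s: "s \<in> {0..1}"
    let ?a = "iter n (dil s x)" and ?m = "iter' n (dil s x) (dil s h)"
    have a: "?a \<in> cball 0 \<rho>" by (rule admissible_in_cball[OF admissible_iter s x])
    have "norm ?m \<le> 2 * C * norm (dil s h)" by (rule Suc.IH[OF dil_in_ball[OF s x]])
    also have "\<dots> \<le> 2 * C * norm h" using norm_dil_le[OF s] \<open>0 \<le> C\<close> by (intro mult_left_mono) auto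
    finally have m: "norm ?m \<le> 2 * C * norm h" .
    have "F' (s, x, ?a) (0, h, ?m) = F' (s, x, ?a) (0, h, 0) + F' (s, x, ?a) (0, 0, ?m)"
      using linear_add[OF F'_linear[OF s x a], of "(0, h, 0)" "(0, 0, ?m)"] by simp
    also have "norm \<dots> \<le> C * norm h + norm ?m / 2"
      using C[OF s x a, of "(0, h, 0)"] F_contraction[OF s x a, of ?m]
      by (intro norm_triangle_mono) (simp_all add: norm_Pair)
    finally show "norm (F' (s, x, ?a) (0, h, ?m)) \<le> 2 * C * norm h" using m by simp
  qed
qed

text \<open>Two errors add up. Evaluating \<open>F'\<close> at different iterates costs e times the
  norm of the direction, at most 1 + 2C by \<open>iter'_le\<close>; the difference of the
  derivatives themselves is halved by the contraction.\<close>

lemma iter'_diff_step: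
  assumes "0 \<le> C" "0 \<le> e"
    and C: "\<And>s x a k. s \<in> {0..1} \<Longrightarrow> x \<in> ball 0 r \<Longrightarrow> a \<in> cball 0 \<rho> \<Longrightarrow> norm (F' (s, x, a) k) \<le> C * norm k"
    and q: "\<And>x h. x \<in> ball 0 r \<Longrightarrow> norm (iter' n x h - iter' m x h) \<le> q * norm h"
    and e: "\<And>s x k. s \<in> {0..1} \<Longrightarrow> x \<in> ball 0 r \<Longrightarrow>
      norm (F' (s, x, iter n (dil s x)) k - F' (s, x, iter m (dil s x)) k) \<le> e * norm k"
    and x: "x \<in> ball 0 r" and "0 \<le> q"
  shows "norm (iter' (Suc n) x h - iter' (Suc m) x h) \<le> (e * (1 + 2 * C) + q / 2) * norm h"
proof -
  note cont = continuous_on_iter'_integrand[OF x]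
  have "iter' (Suc n) x h - iter' (Suc m) x h = integral {0..1} (\<lambda>s.
      F' (s, x, iter n (dil s x)) (0, h, iter' n (dil s x) (dil s h)) -
      F' (s, x, iter m (dil s x)) (0, h, iter' m (dil s x) (dil s h)))"
    unfolding iter'_Suc[OF x]
    by (rule Henstock_Kurzweil_Integration.integral_diff[symmetric]; intro integrable_continuous_interval cont)
  also have "norm \<dots> \<le> (e * (1 + 2 * C) + q / 2) * norm h"
  proof (rule norm_integral_unit_le[OF continuous_on_diff[OF cont cont]])
    fix s :: real assume s: "s \<in> {0..1}"
    let ?a = "iter n (dil s x)" and ?m = "iter' n (dil s x) (dil s h)"
    let ?b = "iter m (dil s x)" and ?k = "iter' m (dil s x) (dil s h)"
    have b: "?b \<in> cball 0 \<rho>" by (rule admissible_in_cball[OF admissible_iter s x])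
    have "F' (s, x, ?b) (0, 0, ?m - ?k) = F' (s, x, ?b) (0, h, ?m) - F' (s, x, ?b) (0, h, ?k)"
      using linear_diff[OF F'_linear[OF s x b], of "(0, h, ?m)" "(0, h, ?k)"] by simp
    then have eq: "F' (s, x, ?a) (0, h, ?m) - F' (s, x, ?b) (0, h, ?k) =
       (F' (s, x, ?a) (0, h, ?m) - F' (s, x, ?b) (0, h, ?m)) + F' (s, x, ?b) (0, 0, ?m - ?k)"
      by simp
    have "norm ?m \<le> 2 * C * norm (dil s h)"
      by (rule iter'_le[OF \<open>0 \<le> C\<close> C dil_in_ball[OF s x]])
    also have "\<dots> \<le> 2 * C * norm h"
      using norm_dil_le[OF s] \<open>0 \<le> C\<close> by (intro mult_left_mono) auto
    finally have "norm (0::real, h, ?m) \<le> (1 + 2 * C) * norm h"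
      using norm_Pair_le[of h ?m] by (simp add: norm_Pair algebra_simps)
    then have 1: "norm (F' (s, x, ?a) (0, h, ?m) - F' (s, x, ?b) (0, h, ?m)) \<le> e * ((1 + 2 * C) * norm h)"
      using e[OF s x, of "(0, h, ?m)"] mult_left_mono[OF _ \<open>0 \<le> e\<close>] by fastforce
    have "norm (F' (s, x, ?b) (0, 0, ?m - ?k)) \<le> norm (?m - ?k) / 2"
      by (rule F_contraction[OF s x b])
    also have "\<dots> \<le> q * norm (dil s h) / 2"
      using q[OF dil_in_ball[OF s x]] by simp
    also have "\<dots> \<le> q * norm h / 2"
      using norm_dil_le[OF s, of h] \<open>0 \<le> q\<close> by (simp add: mult_left_mono)
    finally have 2: "norm (F' (s, x, ?b) (0, 0, ?m - ?k)) \<le> q * norm h / 2" .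
    show "norm (F' (s, x, ?a) (0, h, ?m) - F' (s, x, ?b) (0, h, ?k)) \<le> (e * (1 + 2 * C) + q / 2) * norm h"
      unfolding eq using norm_triangle_mono[OF 1 2] by (simp add: algebra_simps)
  qed
  finally show ?thesis .
qed

lemma iter'_Cauchy:
  assumes u: "admissible u" "\<And>x. x \<in> ball 0 r \<Longrightarrow> u x = step u x" and "0 < \<epsilon>"
  shows "\<exists>M. \<forall>n\<ge>M. \<forall>i. \<forall>x\<in>ball 0 r. \<forall>h. norm (iter' (n + i) x h - iter' n x h) \<le> \<epsilon> * norm h"
proof -
  obtain C where "0 \<le> C" and C: "\<And>s x a k. s \<in> {0..1} \<Longrightarrow> x \<in> ball 0 r \<Longrightarrow> a \<in> cball 0 \<rho> \<Longrightarrow>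
    norm (F' (s, x, a) k) \<le> C * norm k" using F'_bound by blast
  \<comment> \<open>This makes the additive error \<open>e * (1 + 2 * C)\<close> equal to
    \<open>\<epsilon> / 4\<close>, and the recursion q -> \<open>\<epsilon> / 4 + q / 2\<close> has
    the fixed value \<open>\<epsilon> / 2\<close>.\<close>
  define e where "e = \<epsilon> / (4 * (1 + 2 * C))"
  have "0 < e" using \<open>0 < \<epsilon>\<close> \<open>0 \<le> C\<close> by (simp add: e_def)
  obtain d where "0 < d" and d: "\<And>s x a b k. s \<in> {0..1} \<Longrightarrow> x \<in> ball 0 r \<Longrightarrow> a \<in> cball 0 \<rho> \<Longrightarrow>
    b \<in> cball 0 \<rho> \<Longrightarrow> norm (a - b) < d \<Longrightarrow> norm (F' (s, x, a) k - F' (s, x, b) k) \<le> e * norm k"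
    using F'_uniformly_continuous[OF \<open>0 < e\<close>] by blast
  have small: "\<exists>N. A / 2 ^ N < \<delta>" if "0 < \<delta>" for A \<delta> :: real
  proof -
    have "(\<lambda>n. A * (1/2) ^ n) \<longlonglongrightarrow> A * 0" by (intro tendsto_mult tendsto_const LIMSEQ_power_zero) simp
    then have "\<forall>\<^sub>F n in sequentially. A * (1/2) ^ n < \<delta>" using \<open>0 < \<delta>\<close> by (auto intro: order_tendstoD)
    then show ?thesis by (auto simp: eventually_sequentially power_one_over)
  qed
  obtain N where N: "\<rho> / 2 ^ N < d / 2" using small[of "d/2"] \<open>0 < d\<close> by auto
  obtain J where J: "4 * C / 2 ^ J < \<epsilon> / 2" using small[of "\<epsilon>/2" "4 * C"] \<open>0 < \<epsilon>\<close> half_gt_zero by blast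
  have close: "norm (iter n y - u y) < d / 2" if "n \<ge> N" "y \<in> ball 0 r" for n y
  proof -
    have "norm (iter n y - u y) \<le> \<rho> / 2 ^ n" by (rule iter_tendsto_fixpoint[OF u that(2)])
    also have "\<dots> \<le> \<rho> / 2 ^ N" using that(1) rho_nonneg by (intro divide_left_mono power_increasing) auto
    finally show ?thesis using N by (rule le_less_trans)
  qed
  have iter_close: "norm (iter n y - iter m y) < d" if "n \<ge> N" "m \<ge> N" "y \<in> ball 0 r" for n m y
    using close[OF that(1,3)] close[OF that(2,3)] norm_triangle_ineq4[of "iter n y - u y" "iter m y - u y"]
    by simp
  \<comment> \<open>From index N on the iterates are within d of each other, so the recursion
    applies. Its initial value 4C is the triangle inequality for two derivatives bounded by 2C, and
    each further step halves this part.\<close>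
  have main: "norm (iter' (N + j + i) x h - iter' (N + j) x h) \<le> (4 * C / 2 ^ j + \<epsilon> / 2) * norm h"
    if "x \<in> ball 0 r" for i j x h
    using that
  proof (induction j arbitrary: x h)
    case 0
    have "norm (iter' (N + 0 + i) x h - iter' (N + 0) x h) \<le> 4 * C * norm h"
      using norm_triangle_ineq4[of "iter' (N + i) x h" "iter' N x h"]
        iter'_le[OF \<open>0 \<le> C\<close> C 0, of "N + i" h] iter'_le[OF \<open>0 \<le> C\<close> C 0, of N h] by simp
    also have "\<dots> \<le> (4 * C / 2 ^ 0 + \<epsilon> / 2) * norm h"
      using \<open>0 < \<epsilon>\<close> by (intro mult_right_mono) auto
    finally show ?case .
  next
    case (Suc j)
    have "norm (iter' (Suc (N + j + i)) x h - iter' (Suc (N + j)) x h)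
      \<le> (e * (1 + 2 * C) + (4 * C / 2 ^ j + \<epsilon> / 2) / 2) * norm h"
    proof (rule iter'_diff_step[OF \<open>0 \<le> C\<close> less_imp_le[OF \<open>0 < e\<close>] C Suc.IH _ Suc.prems])
      fix s :: real and x :: 'e and k assume sx: "s \<in> {0..1}" "x \<in> ball 0 r"
      show "norm (F' (s, x, iter (N + j + i) (dil s x)) k - F' (s, x, iter (N + j) (dil s x)) k) \<le> e * norm k"
        by (intro d sx admissible_in_cball[OF admissible_iter] iter_close dil_in_ball) auto
    qed (use \<open>0 \<le> C\<close> \<open>0 < \<epsilon>\<close> in auto)
    also have "e * (1 + 2 * C) = \<epsilon> / 4"
      using \<open>0 \<le> C\<close> add_pos_nonneg[of 1 "2 * C"] unfolding e_def by (simp add: divide_simps)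
    finally show ?case by (simp add: field_simps)
  qed
  show ?thesis
  proof (intro exI allI ballI impI)
    fix n i :: nat and x h :: 'e assume "n \<ge> N + J" and x: "x \<in> ball 0 r"
    then obtain j where n: "n = N + j" and j: "j \<ge> J" by (metis add_leD1 le_Suc_ex nat_add_left_cancel_le)
    have "4 * C / 2 ^ j \<le> 4 * C / 2 ^ J"
      using j \<open>0 \<le> C\<close> by (intro divide_left_mono power_increasing) auto
    then have "(4 * C / 2 ^ j + \<epsilon> / 2) * norm h \<le> \<epsilon> * norm h"
      using J by (intro mult_right_mono) auto
    then show "norm (iter' (n + i) x h - iter' n x h) \<le> \<epsilon> * norm h"
      using main[OF x, of j i h] n by simp
  qed
qed

text \<open>The Cauchy estimate is uniform in x and relative to the norm of h, the form of
  convergence under which a limit may be differentiated termwise. The limit function so produced is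
  u by \<open>iter_tendsto_fixpoint\<close>, and uniform convergence in x keeps each directional
  derivative continuous.\<close>

theorem fixpoint_C1:
  assumes u: "admissible u" "\<And>x. x \<in> ball 0 r \<Longrightarrow> u x = step u x"
  obtains u' where "\<And>x. x \<in> ball 0 r \<Longrightarrow> (u has_derivative u' x) (at x)"
    "\<And>h. continuous_on (ball 0 r) (\<lambda>x. u' x h)"
proof -
  have conv: "convergent (\<lambda>n. iter' n x h)" if x: "x \<in> ball 0 r" for x h
  proof (rule Cauchy_convergent, rule metric_CauchyI)
    fix e :: real assume "0 < e"
    define \<epsilon> where "\<epsilon> = e / (2 * (norm h + 1))"
    have "0 < \<epsilon>" using \<open>0 < e\<close> by (simp add: \<epsilon>_def add_nonneg_pos)
    obtain M where M: "\<And>n i x h. n \<ge> M \<Longrightarrow> x \<in> ball 0 r \<Longrightarrow> norm (iter' (n + i) x h - iter' n x h) \<le> \<epsilon> * norm h"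
      using iter'_Cauchy[of u \<epsilon>] u \<open>0 < \<epsilon>\<close> by blast
    have "\<epsilon> * norm h < e / 2"
    proof -
      have "\<epsilon> * norm h < \<epsilon> * (norm h + 1)" using \<open>0 < \<epsilon>\<close> by simp
      also have "\<dots> = e / 2" using norm_ge_zero[of h] by (simp add: \<epsilon>_def field_simps add_nonneg_eq_0_iff)
      finally show ?thesis .
    qed
    then have "norm (iter' n x h - iter' M x h) < e / 2" if "n \<ge> M" for n
      using M[of M x "n - M" h] x that by simp
    then have "dist (iter' m x h) (iter' n x h) < e" if "m \<ge> M" "n \<ge> M" for m n
      using that dist_triangle_half_l[of "iter' m x h" "iter' M x h" e "iter' n x h"] by (simp add: dist_norm)
    then show "\<exists>M. \<forall>m\<ge>M. \<forall>n\<ge>M. dist (iter' m x h) (iter' n x h) < e" by blast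
  qed
  define u' where "u' x h = lim (\<lambda>n. iter' n x h)" for x h
  have lim: "(\<lambda>n. iter' n x h) \<longlonglongrightarrow> u' x h" if "x \<in> ball 0 r" for x h
    using conv[OF that] by (simp add: u'_def convergent_LIMSEQ_iff)
  have unif: "\<forall>\<^sub>F n in sequentially. \<forall>x\<in>ball 0 r. \<forall>h. norm (iter' n x h - u' x h) \<le> \<epsilon> * norm h"
    if "0 < \<epsilon>" for \<epsilon>
  proof -
    obtain M where M: "\<And>n i x h. n \<ge> M \<Longrightarrow> x \<in> ball 0 r \<Longrightarrow> norm (iter' (n + i) x h - iter' n x h) \<le> \<epsilon> * norm h"
      using iter'_Cauchy[of u \<epsilon>] u \<open>0 < \<epsilon>\<close> by blast
    have "norm (iter' n x h - u' x h) \<le> \<epsilon> * norm h" if "n \<ge> M" "x \<in> ball 0 r" for n x h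
    proof -
      have "(\<lambda>i. iter' (n + i) x h - iter' n x h) \<longlonglongrightarrow> u' x h - iter' n x h"
        using LIMSEQ_ignore_initial_segment[OF lim[OF that(2)], of n h]
        by (intro tendsto_diff tendsto_const) (simp add: add.commute)
      then have "norm (u' x h - iter' n x h) \<le> \<epsilon> * norm h"
        by (rule Lim_norm_ubound[OF sequentially_bot]) (use M[OF that] in auto)
      then show ?thesis by (simp add: norm_minus_commute)
    qed
    then show ?thesis unfolding eventually_sequentially by blast
  qed
  have lim_u: "(\<lambda>n. iter n x) \<longlonglongrightarrow> u x" if "x \<in> ball 0 r" for x
  proof (rule LIM_zero_cancel, rule Lim_null_comparison)
    show "\<forall>\<^sub>F n in sequentially. norm (iter n x - u x) \<le> \<rho> * (1/2) ^ n"
      using iter_tendsto_fixpoint[OF u that] by (simp add: power_one_over)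
    show "(\<lambda>n. \<rho> * (1/2) ^ n) \<longlonglongrightarrow> 0"
      by (intro tendsto_mult_right_zero LIMSEQ_power_zero) simp
  qed
  have "\<exists>g. \<forall>x\<in>ball 0 r. (\<lambda>n. iter n x) \<longlonglongrightarrow> g x \<and> (g has_derivative u' x) (at x within ball 0 r)"
  proof (rule has_derivative_sequence[where f=iter and f'=iter' and g'=u' and ?x0.0=0 and l="u 0"])
    show "(iter n has_derivative iter' n x) (at x within ball 0 r)" if "x \<in> ball 0 r" for n x
      by (rule has_derivative_at_withinI[OF has_derivative_iter(1)[OF that]])
  qed (use unif lim_u r_pos in auto)
  then obtain g where g: "\<And>x. x \<in> ball 0 r \<Longrightarrow> (\<lambda>n. iter n x) \<longlonglongrightarrow> g x"
    "\<And>x. x \<in> ball 0 r \<Longrightarrow> (g has_derivative u' x) (at x within ball 0 r)" by blast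
  have gu: "g x = u x" if "x \<in> ball 0 r" for x
    using LIMSEQ_unique g(1) lim_u that by blast
  show thesis
  proof (rule that)
    show "(u has_derivative u' x) (at x)" if "x \<in> ball 0 r" for x
      using g(2)[OF that] at_within_open[OF that open_ball]
      by (metis gu has_derivative_transform_within_open open_ball that)
    show "continuous_on (ball 0 r) (\<lambda>x. u' x h)" for h
    proof (rule uniform_limit_theorem[where f="\<lambda>n x. iter' n x h" and F=sequentially])
      show "uniform_limit (ball 0 r) (\<lambda>n x. iter' n x h) (\<lambda>x. u' x h) sequentially"
        unfolding uniform_limit_iff
      proof (intro allI impI)
        fix e :: real assume "0 < e"
        then have "0 < e / (norm h + 1)" by (simp add: add_nonneg_pos)
        moreover have "0 < 1 + norm h" by (simp add: add_pos_nonneg)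
        then have "e / (norm h + 1) * norm h < e"
          using \<open>0 < e\<close> by (simp add: field_simps)
        ultimately show "\<forall>\<^sub>F n in sequentially. \<forall>x\<in>ball 0 r. dist (iter' n x h) (u' x h) < e"
          by (intro eventually_mono[OF unif]) (auto simp: dist_norm dest!: bspec spec[of _ h] intro: le_less_trans)
      qed
    qed (use has_derivative_iter(2) in auto)
  qed
qed

text \<open>Both sides of the fixed point equation agree on an open ball, hence so do their
  derivatives; the outcome is linear in \<open>u'\<close>, and this linear equation feeds the
  bootstrapping.\<close>

lemma fixpoint_derivative:
  assumes u: "admissible u" "\<And>x. x \<in> ball 0 r \<Longrightarrow> u x = step u x"
    and du: "\<And>x. x \<in> ball 0 r \<Longrightarrow> (u has_derivative u' x) (at x)"
    and cu': "\<And>h. continuous_on (ball 0 r) (\<lambda>x. u' x h)"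
    and x: "x \<in> ball 0 r"
  shows "u' x h = integral {0..1} (\<lambda>s. F' (s, x, u (dil s x)) (0, h, u' (dil s x) (dil s h)))"
proof -
  have "(u has_derivative
      (\<lambda>h. integral {0..1} (\<lambda>s. F' (s, x, u (dil s x)) (0, h, u' (dil s x) (dil s h))))) (at x)"
    by (rule has_derivative_transform_within_open[OF has_derivative_step(1)[OF u(1) du cu' x] open_ball x])
      (use u(2) in auto)
  from has_derivative_unique[OF du[OF x] this] show ?thesis by (rule fun_cong)
qed

text \<open>If \<open>F\<close> is homogeneous along the dilation orbit of \<open>x\<close>, then substituting \<open>t = \<tau> s\<close> turns the fixed
  point equation at \<open>dil \<tau> x\<close> into \<open>u (dil \<tau> x) = \<integral>\<^sub>0\<^sup>\<tau> F (t, x, u (dil t x)) dt\<close>.\<close>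

lemma fixpoint_radial_derivative:
  assumes u: "admissible u" "\<And>x. x \<in> ball 0 r \<Longrightarrow> u x = step u x"
    and x: "x \<in> ball 0 r" and du: "(u has_derivative u') (at x)"
    and hom: "\<And>s \<tau> a. F (s, dil \<tau> x, a) = \<tau> *\<^sub>R F (\<tau> * s, x, a)"
    and dil_dil: "\<And>s \<tau>. dil s (dil \<tau> x) = dil (\<tau> * s) x" and dil_1: "dil 1 x = x"
    and ddil: "((\<lambda>\<tau>. dil \<tau> x) has_vector_derivative d) (at 1)"
  shows "u' d = F (1, x, u x)"
proof -
  define G where "G t = F (t, x, u (dil t x))" for t
  have cG: "continuous_on {0..1} G"
    unfolding G_def by (rule admissible_continuous[OF u(1) x])
  have eq: "u (dil \<tau> x) = integral {0..\<tau>} G" if \<tau>: "\<tau> \<in> {0..1}" for \<tau>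
  proof -
    have "((\<lambda>s. \<tau> *\<^sub>R G (\<tau> * s)) has_integral (integral {\<tau> * 0..\<tau> * 1} G)) {0..1}"
    proof (rule has_integral_substitution[where c=0 and d=1])
      show "(\<lambda>s. \<tau> * s) ` {0..1} \<subseteq> {0..1}" using \<tau> by (auto simp: mult_le_one)
      show "((*) \<tau> has_field_derivative \<tau>) (at s within {0..1})" for s
        by (auto intro!: derivative_eq_intros)
    qed (use cG \<tau> in auto)
    then have "integral {0..1} (\<lambda>s. \<tau> *\<^sub>R G (\<tau> * s)) = integral {0..\<tau>} G"
      by (simp only: mult_zero_right mult_1_right integral_unique)
    then show ?thesis
      using u(2)[OF dil_in_ball[OF \<tau> x]] by (simp add: step_def hom dil_dil G_def)
  qed
  \<comment> \<open>The integral formula is established on \<open>{0..1}\<close> only, so at its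
    right end it yields a one-sided derivative, which is compared with the restriction of the
    two-sided one.\<close>
  have "((\<lambda>\<tau>. integral {0..\<tau>} G) has_vector_derivative G 1) (at 1 within {0..1})"
    by (rule integral_has_vector_derivative[OF cG]) simp
  then have 1: "((\<lambda>\<tau>. u (dil \<tau> x)) has_vector_derivative G 1) (at 1 within {0..1})"
    by (rule has_vector_derivative_transform[rotated 2]) (use eq in auto)
  have "((\<lambda>\<tau>. u (dil \<tau> x)) has_derivative (\<lambda>h. u' (h *\<^sub>R d))) (at 1)"
    using ddil unfolding has_vector_derivative_def
    by (rule has_derivative_compose) (simp add: dil_1 du)
  then have "((\<lambda>\<tau>. u (dil \<tau> x)) has_vector_derivative u' d) (at 1)"
    unfolding has_vector_derivative_def
    using linear_cmul[OF has_derivative_linear[OF du]] by simp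
  then have 2: "((\<lambda>\<tau>. u (dil \<tau> x)) has_vector_derivative u' d) (at 1 within {0..1})"
    by (rule has_vector_derivative_at_within)
  have "u' d = G 1"
    by (rule vector_derivative_unique_within_closed_interval[of 0 1 1, OF _ _ 2[folded cbox_interval] 1[folded cbox_interval]]) auto
  then show ?thesis by (simp add: G_def dil_1)
qed

end

subsection \<open>Smoothness of the fixed point\<close>

text \<open>Coefficients that are continuous on an open ball are bounded only on smaller closed
  balls, so regularity is obtained radius by radius. The local derivatives fit together because each
  equals \<open>frechet_derivative\<close>.\<close>

lemma C1_on_ball_exhaust:
  fixes w :: "'e::euclidean_space \<Rightarrow> 'v::euclidean_space"
  assumes "\<And>r. 0 < r \<Longrightarrow> r < R \<Longrightarrow> \<exists>u'. (\<forall>x\<in>ball 0 r. (w has_derivative u' x) (at x)) \<and>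
      (\<forall>h. continuous_on (ball 0 r) (\<lambda>x. u' x h))"
  shows "x \<in> ball 0 R \<Longrightarrow> (w has_derivative frechet_derivative w (at x)) (at x)"
    and "continuous_on (ball 0 R) (\<lambda>x. frechet_derivative w (at x) h)"
proof -
  have *: "(w has_derivative frechet_derivative w (at x)) (at x)
      \<and> isCont (\<lambda>x. frechet_derivative w (at x) h) x" if x: "x \<in> ball 0 R" for x h
  proof -
    define r where "r = (norm x + R) / 2"
    have "0 \<le> norm x" "norm x < R" using x by auto
    then have r: "0 < r" "r < R" "x \<in> ball 0 r" using le_less_trans[of 0 "norm x" R] add_nonneg_pos[of "norm x" R] by (auto simp: r_def)
    obtain u' where u': "\<And>x. x \<in> ball 0 r \<Longrightarrow> (w has_derivative u' x) (at x)"
      "\<And>h. continuous_on (ball 0 r) (\<lambda>x. u' x h)" using assms[OF r(1,2)] by blast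
    have eq: "u' y = frechet_derivative w (at y)" if "y \<in> ball 0 r" for y
      by (rule frechet_derivative_at[OF u'(1)[OF that]])
    have "continuous_on (ball 0 r) (\<lambda>x. frechet_derivative w (at x) h)"
      by (rule continuous_on_eq[OF u'(2)]) (simp add: eq)
    then have "isCont (\<lambda>x. frechet_derivative w (at x) h) x"
      using r(3) continuous_on_eq_continuous_at open_ball by blast
    then show ?thesis using u'(1)[OF r(3)] eq[OF r(3)] by simp
  qed
  show "x \<in> ball 0 R \<Longrightarrow> (w has_derivative frechet_derivative w (at x)) (at x)"
    using * by blast
  show "continuous_on (ball 0 R) (\<lambda>x. frechet_derivative w (at x) h)"
    using * by (intro continuous_at_imp_continuous_on) blast
qed

context dilation
begin

text \<open>\<open>{0..1} \<times> ball 0 R\<close> is not open, so the regularity of the coefficients is required on an open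
  neighbourhood \<open>\<Theta>\<close> of it, small enough that \<open>w (dil s x)\<close> is regular there as well.\<close>

lemma linear_integral_eq_Ck:
  fixes A :: "'v::euclidean_space \<Rightarrow> real \<times> 'e \<Rightarrow> 'v"
  assumes \<Theta>: "open \<Theta>" "{0..1} \<times> ball 0 R \<subseteq> \<Theta>" "\<And>z. z \<in> \<Theta> \<Longrightarrow> dil (fst z) (snd z) \<in> ball 0 R"
    and A: "\<And>j. j \<in> Basis \<Longrightarrow> Ck_on k \<Theta> (A j)" and B: "Ck_on k \<Theta> B"
    and A_le: "\<And>s x m. s \<in> {0..1} \<Longrightarrow> x \<in> ball 0 R \<Longrightarrow>
      norm (\<Sum>j\<in>Basis. (m \<bullet> j) *\<^sub>R A j (s, x)) \<le> norm m / 2"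
    and w: "continuous_on (ball 0 R) w" "\<And>x. x \<in> ball 0 R \<Longrightarrow>
      w x = integral {0..1} (\<lambda>s. (\<Sum>j\<in>Basis. (w (dil s x) \<bullet> j) *\<^sub>R A j (s, x)) + B (s, x))"
  shows "Ck_on k (ball 0 R) w"
  using A B A_le w
proof (induction k arbitrary: A B w)
  case 0
  then show ?case by simp
next
  case (Suc k)
  note A = Suc.prems(1) and B = Suc.prems(2) and A_le = Suc.prems(3) and w = Suc.prems(4,5)
  \<comment> \<open>Regularity of one order less is needed first, since w itself enters the
    inhomogeneity \<open>B2\<close> of the equation for its derivatives.\<close>
  have wk: "Ck_on k (ball 0 R) w"
    by (rule Suc.IH[OF Ck_on_SucD[OF A] Ck_on_SucD[OF B] A_le w])
  define DA where "DA j z = frechet_derivative (A j) (at z)" for j z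
  define DB where "DB z = frechet_derivative B (at z)" for z
  define P where "P z = (fst z, fst (snd z))" for z :: "real \<times> 'e \<times> 'v"
  have bP: "bounded_linear P"
    unfolding P_def by (intro bounded_linear_Pair bounded_linear_fst
        bounded_linear_compose[OF bounded_linear_fst bounded_linear_snd])
  \<comment> \<open>\<open>P\<close> forgets the unknown. As the equation is linear, the unknown may
    range over the whole space, which leaves \<open>\<rho>\<close> free to be chosen large
    below.\<close>
  define \<Omega> where "\<Omega> = P -` \<Theta>"
  have "open \<Omega>"
    unfolding \<Omega>_def using \<Theta>(1) bP by (intro open_vimage linear_continuous_on)
  define F where "F z = (\<Sum>j\<in>Basis. (snd (snd z) \<bullet> j) *\<^sub>R A j (P z)) + B (P z)" for z
  define F' where "F' z h = (\<Sum>j\<in>Basis. (snd (snd z) \<bullet> j) *\<^sub>R DA j (P z) (P h)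
      + (snd (snd h) \<bullet> j) *\<^sub>R A j (P z)) + DB (P z) (P h)" for z h
  have dA: "((\<lambda>z. A j (P z)) has_derivative (\<lambda>h. DA j (P z) (P h))) (at z)"
    if "j \<in> Basis" "z \<in> \<Omega>" for j z
    unfolding DA_def using that A[OF that(1)]
    by (intro has_derivative_compose[OF bounded_linear_imp_has_derivative[OF bP]] Ck_on_has_derivative)
      (auto simp: \<Omega>_def)
  have dB: "((\<lambda>z. B (P z)) has_derivative (\<lambda>h. DB (P z) (P h))) (at z)" if "z \<in> \<Omega>" for z
    unfolding DB_def using that B
    by (intro has_derivative_compose[OF bounded_linear_imp_has_derivative[OF bP]] Ck_on_has_derivative)
      (auto simp: \<Omega>_def)
  have dF: "(F has_derivative F' z) (at z)" if "z \<in> \<Omega>" for z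
    unfolding F_def[abs_def] F'_def[abs_def]
    by (intro has_derivative_add has_derivative_sum has_derivative_scaleR has_derivative_inner_left
        has_derivative_snd has_derivative_ident dA dB that)
  have c1: "continuous_on \<Omega> (\<lambda>z. g (P z))" if "continuous_on \<Theta> g" for g :: "real \<times> 'e \<Rightarrow> 'v"
    by (rule continuous_on_compose2[OF that linear_continuous_on[OF bP]]) (auto simp: \<Omega>_def)
  have cF': "continuous_on \<Omega> (\<lambda>z. F' z h)" for h
    unfolding F'_def
  proof (intro continuous_intros c1)
    show "continuous_on \<Theta> (\<lambda>x. DA j x (P h))" if "j \<in> Basis" for j
      using A[OF that] unfolding DA_def
      by (intro Ck_on_imp_continuous_on[of k]) (simp del: split_paired_All)
    show "continuous_on \<Theta> (A j)" if "j \<in> Basis" for j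
      using A[OF that] Ck_on_imp_continuous_on by blast
    show "continuous_on \<Theta> (\<lambda>x. DB x (P h))"
      using B unfolding DB_def
      by (intro Ck_on_imp_continuous_on[of k]) (simp del: split_paired_All)
  qed
  have in_dom: "(s, x, a) \<in> \<Omega>" if "s \<in> {0..1}" "x \<in> ball 0 R" for s x a
    using \<Theta>(2) that by (auto simp: \<Omega>_def P_def simp del: mem_ball mem_ball_0)
  have C1: "\<exists>u'. (\<forall>x\<in>ball 0 r. (w has_derivative u' x) (at x)) \<and>
      (\<forall>h. continuous_on (ball 0 r) (\<lambda>x. u' x h))" if r: "0 < r" "r < R" for r
  proof -
    have sub: "cball 0 r \<subseteq> ball (0::'e) R" using r by auto
    have "{0..1} \<times> cball (0::'e) r \<subseteq> \<Theta>" using sub \<Theta>(2) by blast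
    then have "continuous_on ({0..1} \<times> cball 0 r) B"
      using continuous_on_subset Ck_on_imp_continuous_on[OF B] by blast
    then obtain b where "0 \<le> b" and b: "\<And>z. z \<in> {0..1} \<times> cball 0 r \<Longrightarrow> norm (B z) \<le> b"
      by (rule continuous_on_compact_norm_bound[rotated]) (auto intro: compact_Times)
    obtain d where "0 \<le> d" and d: "\<And>x. x \<in> cball 0 r \<Longrightarrow> norm (w x) \<le> d"
      by (rule continuous_on_compact_norm_bound[OF compact_cball continuous_on_subset[OF w(1) sub]]) blast
    \<comment> \<open>The part 2b gives \<open>\<rho> / 2 + b \<le> \<rho>\<close>, hence invariance
      of the ball under the affine map; the part d makes the given solution w admissible.\<close>
    define \<rho> where "\<rho> = 2 * b + d"
    interpret picard c F F' \<Omega> r \<rho>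
    proof
      show "{0..1} \<times> cball 0 r \<times> cball 0 \<rho> \<subseteq> \<Omega>" using in_dom sub by blast
      show "0 \<le> \<rho>" using \<open>0 \<le> b\<close> \<open>0 \<le> d\<close> by (simp add: \<rho>_def)
    next
      fix s :: real and x :: 'e and a m :: 'v
      assume s: "s \<in> {0..1}" and x: "x \<in> ball 0 r" and a: "a \<in> cball 0 \<rho>"
      have x': "x \<in> ball 0 R" "x \<in> cball 0 r" using x r by auto
      have "norm (F (s, x, a)) \<le> norm a / 2 + b"
        unfolding F_def P_def using A_le[OF s x'(1), of a] b[of "(s, x)"] s x'(2)
        by (intro norm_triangle_mono) auto
      also have "\<dots> \<le> \<rho>" using a \<open>0 \<le> d\<close> by (simp add: \<rho>_def)
      finally show "norm (F (s, x, a)) \<le> \<rho>" .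
      have "linear (DA j (P (s, x, a)))" "linear (DB (P (s, x, a)))" if "j \<in> Basis" for j
        unfolding DA_def DB_def using in_dom[OF s x'(1), of a]
        by (auto simp: \<Omega>_def intro!: has_derivative_linear[OF Ck_on_has_derivative[OF A[OF that]]]
            has_derivative_linear[OF Ck_on_has_derivative[OF B]])
      then have "F' (s, x, a) (0, 0, m) = (\<Sum>j\<in>Basis. (m \<bullet> j) *\<^sub>R A j (s, x))"
        using nonempty_Basis unfolding F'_def P_def
        by (fastforce simp: zero_prod_def[symmetric] linear_0 intro!: sum.cong)
      then show "norm (F' (s, x, a) (0, 0, m)) \<le> norm m / 2"
        using A_le[OF s x'(1), of m] by simp
    qed (use dF cF' r in auto)
    have "admissible w"
      unfolding admissible_def
    proof
      show "continuous_on (ball 0 r) w"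
        by (rule continuous_on_subset[OF w(1)]) (use r in auto)
      have "norm (w x) \<le> \<rho>" if "x \<in> ball 0 r" for x
        using d[of x] that \<open>0 \<le> b\<close> by (simp add: \<rho>_def)
      then show "w ` ball 0 r \<subseteq> cball 0 \<rho>" by auto
    qed
    moreover have "w x = step w x" if "x \<in> ball 0 r" for x
      using w(2)[of x] that r by (simp add: step_def F_def P_def)
    ultimately obtain u' where "\<And>x. x \<in> ball 0 r \<Longrightarrow> (w has_derivative u' x) (at x)"
      "\<And>h. continuous_on (ball 0 r) (\<lambda>x. u' x h)"
      by (rule fixpoint_C1) blast+
    then show ?thesis by blast
  qed
  define w' where "w' x = frechet_derivative w (at x)" for x
  have dw: "(w has_derivative w' x) (at x)" if "x \<in> ball 0 R" for x
    unfolding w'_def by (rule C1_on_ball_exhaust(1)[OF C1 that])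
  have cw': "continuous_on (ball 0 R) (\<lambda>x. w' x h)" for h
    unfolding w'_def by (rule C1_on_ball_exhaust(2)[OF C1])
  have w'_eq: "w' x h = integral {0..1} (\<lambda>s. F' (s, x, w (dil s x)) (0, h, w' (dil s x) (dil s h)))"
    if x: "x \<in> ball 0 R" for x h
  proof -
    have "((\<lambda>x. integral {0..1} (\<lambda>s. F (s, x, w (dil s x)))) has_derivative
        (\<lambda>h. integral {0..1} (\<lambda>s. F' (s, x, w (dil s x)) (0, h, w' (dil s x) (dil s h))))) (at x)"
      by (rule has_derivative_integral_dil(1)[OF dF cF' dw cw' in_dom x])
    then have "(w has_derivative
        (\<lambda>h. integral {0..1} (\<lambda>s. F' (s, x, w (dil s x)) (0, h, w' (dil s x) (dil s h))))) (at x)"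
      by (rule has_derivative_transform_within_open[OF _ open_ball x]) (simp add: w(2) F_def P_def)
    from has_derivative_unique[OF dw[OF x] this] show ?thesis by (rule fun_cong)
  qed
  show ?case
  proof (rule Ck_on_SucI_Basis[OF open_ball dw])
    fix b :: 'e assume b: "b \<in> Basis"
    \<comment> \<open>Because \<open>dil s b = c b s *\<^sub>R b\<close>, the derivative along b
      satisfies an equation in that derivative alone, with coefficients \<open>A2\<close>.
      Everything that comes from differentiating the old coefficients goes into
      \<open>B2\<close>.\<close>
    define A2 where "A2 j z = c b (fst z) *\<^sub>R A j z" for j z
    define B2 where "B2 z = (\<Sum>j\<in>Basis. (w (dil (fst z) (snd z)) \<bullet> j) *\<^sub>R DA j z (0, b)) + DB z (0, b)" for z
    show "Ck_on k (ball 0 R) (\<lambda>x. w' x b)"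
    proof (rule Suc.IH[of A2 B2])
      have "Ck_on k \<Theta> (\<lambda>z. c b (fst z))" by (rule Ck_on_c[OF \<Theta>(1) b])
      then show "Ck_on k \<Theta> (A2 j)" if "j \<in> Basis" for j
        unfolding A2_def[abs_def] using Ck_on_SucD[OF A[OF that]] by (intro Ck_on_scaleR \<Theta>(1))
      have "Ck_on k \<Theta> (\<lambda>z. w (dil (fst z) (snd z)))"
        by (rule Ck_on_compose[where f=w and g="\<lambda>z. dil (fst z) (snd z)", OF \<Theta>(1) open_ball _ wk])
          (use \<Theta>(3) Ck_on_subset[OF Ck_on_dil] in auto)
      moreover have "Ck_on k \<Theta> (\<lambda>z. DA j z (0, b))" if "j \<in> Basis" for j
        using A[OF that] unfolding DA_def by simp
      moreover have "Ck_on k \<Theta> (\<lambda>z. DB z (0, b))"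
        using B unfolding DB_def by simp
      ultimately show "Ck_on k \<Theta> B2"
        unfolding B2_def[abs_def]
        by (intro Ck_on_add Ck_on_sum Ck_on_scaleR Ck_on_inner Ck_on_const \<Theta>(1))
    next
      fix s :: real and x :: 'e and m :: 'v
      assume sx: "s \<in> {0..1}" "x \<in> ball 0 R"
      have "(\<Sum>j\<in>Basis. (m \<bullet> j) *\<^sub>R A2 j (s, x)) = c b s *\<^sub>R (\<Sum>j\<in>Basis. (m \<bullet> j) *\<^sub>R A j (s, x))"
        unfolding A2_def by (simp add: scaleR_sum_right mult.commute)
      also have "norm \<dots> \<le> 1 * (norm m / 2)"
        unfolding norm_scaleR using A_le[OF sx, of m] c_le[OF b sx(1)] by (intro mult_mono) auto
      finally show "norm (\<Sum>j\<in>Basis. (m \<bullet> j) *\<^sub>R A2 j (s, x)) \<le> norm m / 2" by simp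
    next
      show "continuous_on (ball 0 R) (\<lambda>x. w' x b)" by (rule cw')
      fix x :: 'e assume x: "x \<in> ball 0 R"
      have "F' (s, x, w (dil s x)) (0, b, w' (dil s x) (dil s b)) =
          (\<Sum>j\<in>Basis. (w' (dil s x) b \<bullet> j) *\<^sub>R A2 j (s, x)) + B2 (s, x)" if "s \<in> {0..1}" for s
      proof -
        have "w' (dil s x) (dil s b) = c b s *\<^sub>R w' (dil s x) b"
          unfolding dil_Basis[OF b]
          by (rule linear_cmul[OF has_derivative_linear[OF dw[OF dil_in_ball[OF that x]]]])
        then show ?thesis
          unfolding F'_def P_def A2_def B2_def
          by (simp add: sum.distrib mult.commute)
      qed
      then show "w' x b = integral {0..1}
          (\<lambda>s. (\<Sum>j\<in>Basis. (w' (dil s x) b \<bullet> j) *\<^sub>R A2 j (s, x)) + B2 (s, x))"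
        unfolding w'_eq[OF x] by (intro integral_cong) simp
    qed
  qed
qed

end

theorem (in picard) fixpoint_smooth:
  assumes u: "admissible u" "\<And>x. x \<in> ball 0 r \<Longrightarrow> u x = step u x"
    and "open \<Omega>" and smooth_F': "\<And>h. smooth_on \<Omega> (\<lambda>z. F' z h)"
    and \<Theta>: "open \<Theta>" "{0..1} \<times> ball 0 r \<subseteq> \<Theta>" "\<And>z. z \<in> \<Theta> \<Longrightarrow> dil (fst z) (snd z) \<in> ball 0 r"
    and \<Theta>_\<Omega>: "\<And>s x a. (s, x) \<in> \<Theta> \<Longrightarrow> a \<in> cball 0 \<rho> \<Longrightarrow> (s, x, a) \<in> \<Omega>"
  shows "smooth_on (ball 0 r) u"
proof -
  obtain u' where du: "\<And>x. x \<in> ball 0 r \<Longrightarrow> (u has_derivative u' x) (at x)"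
    and cu': "\<And>h. continuous_on (ball 0 r) (\<lambda>x. u' x h)"
    using fixpoint_C1[OF u] by blast
  have "Ck_on k (ball 0 r) u" for k
  proof (induction k)
    case 0
    show ?case using u(1) by (simp add: admissible_def)
  next
    case (Suc k)
    let ?z = "\<lambda>z. (fst z, snd z, u (dil (fst z) (snd z)))"
    have z_in: "?z z \<in> \<Omega>" if "z \<in> \<Theta>" for z
      by (rule \<Theta>_\<Omega>) (use that admissible_le[OF u(1) \<Theta>(3)[OF that]] in auto)
    have "Ck_on k \<Theta> (\<lambda>z. u (dil (fst z) (snd z)))"
      by (rule Ck_on_compose[where f=u and g="\<lambda>z. dil (fst z) (snd z)", OF \<Theta>(1) open_ball _ Suc])
        (use \<Theta>(3) Ck_on_subset[OF Ck_on_dil] in auto)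
    then have "Ck_on k \<Theta> ?z"
      by (intro Ck_on_Pair Ck_on_fst Ck_on_snd Ck_on_id \<Theta>(1))
    then have F'_Ck: "Ck_on k \<Theta> (\<lambda>z. F' (?z z) h)" for h
      by (intro Ck_on_compose[where f="\<lambda>z. F' z h" and g="?z", OF \<Theta>(1) \<open>open \<Omega>\<close>])
        (use z_in smooth_F' in \<open>auto simp: smooth_on_def\<close>)
    show ?case
    proof (rule Ck_on_SucI_Basis[OF open_ball du])
      fix b :: 'e assume b: "b \<in> Basis"
      \<comment> \<open>\<open>A\<close> holds the dependence of F on the unknown, weighted by the
        dilation of the axis b, and \<open>B\<close> the explicit dependence on x. Both have the
        regularity of u along \<open>dil\<close>, and \<open>F_contraction\<close> bounds the
        former.\<close>
      define A where "A j z = c b (fst z) *\<^sub>R F' (?z z) (0, 0, j)" for j z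
      define B where "B z = F' (?z z) (0, b, 0)" for z
      have lin: "linear (F' (s, x, u (dil s x)))" if "s \<in> {0..1}" "x \<in> ball 0 r" for s x
        by (intro F'_linear that admissible_in_cball u(1))
      have sum_A: "(\<Sum>j\<in>Basis. (m \<bullet> j) *\<^sub>R A j (s, x)) = c b s *\<^sub>R F' (s, x, u (dil s x)) (0, 0, m)"
        if "s \<in> {0..1}" "x \<in> ball 0 r" for s x m
      proof -
        have "linear (\<lambda>m. F' (s, x, u (dil s x)) (0, 0, m))"
          using linear_compose[OF _ lin[OF that], of "\<lambda>m. (0, 0, m)"]
          by (simp add: o_def linear_iff)
        from linear_eq_sum_Basis[OF this, of m] show ?thesis
          unfolding A_def by (simp add: scaleR_sum_right mult.commute)
      qed
      show "Ck_on k (ball 0 r) (\<lambda>x. u' x b)"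
      proof (rule linear_integral_eq_Ck[OF \<Theta>, where A=A and B=B])
        have "Ck_on k \<Theta> (\<lambda>z. c b (fst z))" by (rule Ck_on_c[OF \<Theta>(1) b])
        then show "Ck_on k \<Theta> (A j)" for j
          unfolding A_def[abs_def] by (intro Ck_on_scaleR F'_Ck \<Theta>(1))
        show "Ck_on k \<Theta> B" unfolding B_def[abs_def] by (rule F'_Ck)
      next
        fix s :: real and x :: 'e and m :: 'v
        assume sx: "s \<in> {0..1}" "x \<in> ball 0 r"
        have "norm (c b s *\<^sub>R F' (s, x, u (dil s x)) (0, 0, m)) \<le> 1 * (norm m / 2)"
          unfolding norm_scaleR
          using F_contraction[OF sx admissible_in_cball[OF u(1) sx], of m] c_le[OF b sx(1)]
          by (intro mult_mono) auto
        then show "norm (\<Sum>j\<in>Basis. (m \<bullet> j) *\<^sub>R A j (s, x)) \<le> norm m / 2"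
          by (simp add: sum_A[OF sx])
      next
        show "continuous_on (ball 0 r) (\<lambda>x. u' x b)" by (rule cu')
        fix x :: 'e assume x: "x \<in> ball 0 r"
        have "F' (s, x, u (dil s x)) (0, b, u' (dil s x) (dil s b)) =
            (\<Sum>j\<in>Basis. (u' (dil s x) b \<bullet> j) *\<^sub>R A j (s, x)) + B (s, x)" if s: "s \<in> {0..1}" for s
        proof -
          have "u' (dil s x) (dil s b) = c b s *\<^sub>R u' (dil s x) b"
            unfolding dil_Basis[OF b]
            by (rule linear_cmul[OF has_derivative_linear[OF du[OF dil_in_ball[OF s x]]]])
          moreover have "F' (s, x, u (dil s x)) (0, b, c b s *\<^sub>R m) =
              F' (s, x, u (dil s x)) (0, b, 0) + c b s *\<^sub>R F' (s, x, u (dil s x)) (0, 0, m)" for m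
            using linear_add[OF lin[OF s x], of "(0, b, 0)" "c b s *\<^sub>R (0, 0, m)"]
              linear_cmul[OF lin[OF s x], of "c b s" "(0, 0, m)"] by simp
          ultimately show ?thesis by (simp add: sum_A[OF s x] B_def)
        qed
        then have "integral {0..1} (\<lambda>s. F' (s, x, u (dil s x)) (0, b, u' (dil s x) (dil s b))) =
            integral {0..1} (\<lambda>s. (\<Sum>j\<in>Basis. (u' (dil s x) b \<bullet> j) *\<^sub>R A j (s, x)) + B (s, x))"
          by (rule integral_cong)
        moreover have "u' x b =
            integral {0..1} (\<lambda>s. F' (s, x, u (dil s x)) (0, b, u' (dil s x) (dil s b)))"
          by (rule fixpoint_derivative[OF u du cu' x])
        ultimately show "u' x b = integral {0..1}
            (\<lambda>s. (\<Sum>j\<in>Basis. (u' (dil s x) b \<bullet> j) *\<^sub>R A j (s, x)) + B (s, x))" by simp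
      qed
    qed
  qed
  then show ?thesis by (simp add: smooth_on_def)
qed

subsection \<open>Smoothness of the inverse map\<close>

text \<open>As \<open>f\<close> preserves the first coordinate, Cramer's rule for the remaining two gives the derivative
  of \<open>g\<close> as a rational expression in the entries of \<open>f' \<circ> g\<close>, which is as regular as \<open>g\<close>.\<close>

lemma smooth_on_inverse_triple:
  fixes f g :: "real \<times> real \<times> real \<Rightarrow> real \<times> real \<times> real"
  assumes "open S" "open T" and f: "smooth_on S f" and gT: "g ` T \<subseteq> S"
    and fst_f: "\<And>x. x \<in> S \<Longrightarrow> fst (f x) = fst x"
    and dg: "\<And>y. y \<in> T \<Longrightarrow> (g has_derivative g' y) (at y)"
    and right_inv: "\<And>y h. y \<in> T \<Longrightarrow> frechet_derivative f (at (g y)) (g' y h) = h"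
    and left_inv: "\<And>y h. y \<in> T \<Longrightarrow> g' y (frechet_derivative f (at (g y)) h) = h"
  shows "smooth_on T g"
proof -
  define L where "L x = frechet_derivative f (at x)" for x
  have df: "(f has_derivative L x) (at x)" if "x \<in> S" for x
    using f that Ck_on_has_derivative[of 0 S f x] unfolding L_def smooth_on_def by blast
  have fst_L: "fst (L x h) = fst h" if "x \<in> S" for x h
  proof -
    have "((\<lambda>x. fst (f x)) has_derivative (\<lambda>h. fst (L x h))) (at x)"
      by (rule has_derivative_fst[OF df[OF that]])
    moreover have "((\<lambda>x. fst (f x)) has_derivative fst) (at x)"
      by (rule has_derivative_transform_within_open[OF _ \<open>open S\<close> that, of fst])
        (auto simp: fst_f intro: bounded_linear_imp_has_derivative bounded_linear_fst)
    ultimately have "(\<lambda>h. fst (L x h)) = fst" by (rule has_derivative_unique)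
    then show ?thesis by (rule fun_cong)
  qed
  define m where "m i x = L x (if i = (0::nat) then (1, 0, 0) else if i = 1 then (0, 1, 0) else (0, 0, 1))" for i x
  define a where "a i x = fst (snd (m i x))" for i x
  define b where "b i x = snd (snd (m i x))" for i x
  have L_eq: "L x h = (fst h, fst h * a 0 x + fst (snd h) * a 1 x + snd (snd h) * a 2 x,
      fst h * b 0 x + fst (snd h) * b 1 x + snd (snd h) * b 2 x)" if "x \<in> S" for x h
  proof -
    have lin: "linear (L x)" using has_derivative_linear[OF df[OF that]] .
    have "h = fst h *\<^sub>R (1, 0, 0) + fst (snd h) *\<^sub>R (0, 1, 0) + snd (snd h) *\<^sub>R (0, 0, 1)"
      by (simp add: prod_eq_iff)
    then have "L x h = L x (fst h *\<^sub>R (1, 0, 0) + fst (snd h) *\<^sub>R (0, 1, 0) + snd (snd h) *\<^sub>R (0, 0, 1))"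
      by simp
    also have "\<dots> = fst h *\<^sub>R m 0 x + fst (snd h) *\<^sub>R m 1 x + snd (snd h) *\<^sub>R m 2 x"
      unfolding m_def by (simp only: linear_add[OF lin] linear_cmul[OF lin]) simp
    finally have "L x h = fst h *\<^sub>R m 0 x + fst (snd h) *\<^sub>R m 1 x + snd (snd h) *\<^sub>R m 2 x" .
    then show ?thesis using fst_L[OF that, of h] unfolding a_def b_def by (simp add: prod_eq_iff)
  qed
  \<comment> \<open>The first row of the Jacobian matrix is (1, 0, 0), so this minor is the full
    Jacobian determinant.\<close>
  define \<Delta> where "\<Delta> x = a 1 x * b 2 x - a 2 x * b 1 x" for x
  have \<Delta>: "\<Delta> (g y) \<noteq> 0" if y: "y \<in> T" for y
  proof
    let ?x = "g y"
    assume 0: "\<Delta> ?x = 0"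
    have x: "?x \<in> S" using y gT by blast
    have inj: "h = 0" if "L ?x h = 0" for h
      using left_inv[OF y, of h] left_inv[OF y, of 0] that linear_0[OF has_derivative_linear[OF df[OF x]]]
      unfolding L_def by simp
    \<comment> \<open>These vectors are the columns of the adjugate matrix, which L maps to
      multiples of \<open>\<Delta>\<close>. By injectivity they vanish, and then L kills the second
      axis.\<close>
    have "L ?x (0, b 2 ?x, - b 1 ?x) = 0" "L ?x (0, - a 2 ?x, a 1 ?x) = 0"
      using 0 unfolding L_eq[OF x] \<Delta>_def by (simp_all add: algebra_simps zero_prod_def)
    then have "a 1 ?x = 0" "b 1 ?x = 0"
      using inj by (fastforce simp: zero_prod_def)+
    then have "L ?x (0, 1, 0) = 0" unfolding L_eq[OF x] by (simp add: zero_prod_def)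
    then show False using inj by (fastforce simp: zero_prod_def)
  qed
  have g'_eq: "g' y h = (fst h,
      (b 2 (g y) * (fst (snd h) - fst h * a 0 (g y)) - a 2 (g y) * (snd (snd h) - fst h * b 0 (g y))) / \<Delta> (g y),
      (a 1 (g y) * (snd (snd h) - fst h * b 0 (g y)) - b 1 (g y) * (fst (snd h) - fst h * a 0 (g y))) / \<Delta> (g y))"
    if y: "y \<in> T" for y h
  proof -
    have x: "g y \<in> S" using y gT by blast
    obtain w1 w2 w3 where w: "g' y h = (w1, w2, w3)" using prod_cases3 by blast
    have "(w1, w1 * a 0 (g y) + w2 * a 1 (g y) + w3 * a 2 (g y),
      w1 * b 0 (g y) + w2 * b 1 (g y) + w3 * b 2 (g y)) = h"
      using right_inv[OF y, of h] L_eq[OF x, of "g' y h"] by (simp add: w L_def)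
    then show ?thesis
      unfolding w using \<Delta>[OF y] by (auto simp: \<Delta>_def field_simps)
  qed
  have L_Ck: "Ck_on k S (\<lambda>x. L x h)" for k h
    using smooth_on_frechet_derivative[OF f] unfolding L_def smooth_on_def by blast
  have "Ck_on k S (a i)" "Ck_on k S (b i)" for k i
    unfolding a_def b_def m_def by (intro Ck_on_fst Ck_on_snd L_Ck \<open>open S\<close>)+
  note ab = this
  have "Ck_on k T g" for k
  proof (induction k)
    case 0
    then show ?case
      by (auto intro!: continuous_at_imp_continuous_on has_derivative_continuous[OF dg])
  next
    case (Suc k)
    have abg: "Ck_on k T (\<lambda>y. a i (g y))" "Ck_on k T (\<lambda>y. b i (g y))" for i
      by (rule Ck_on_compose[OF \<open>open T\<close> \<open>open S\<close> gT ab(1) Suc])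
        (rule Ck_on_compose[OF \<open>open T\<close> \<open>open S\<close> gT ab(2) Suc])
    have \<Delta>g: "Ck_on k T (\<lambda>y. \<Delta> (g y))"
      unfolding \<Delta>_def by (intro Ck_on_diff Ck_on_mult abg \<open>open T\<close>)
    show ?case
    proof (rule Ck_on_SucI[OF \<open>open T\<close> dg])
      fix h
      show "Ck_on k T (\<lambda>y. g' y h)"
        by (rule Ck_on_cong[OF \<open>open T\<close> g'_eq[symmetric]], assumption,
            intro Ck_on_Pair Ck_on_const Ck_on_divide Ck_on_diff Ck_on_mult abg \<Delta>g \<Delta> \<open>open T\<close>)
    qed
  qed
  then show ?thesis by (simp add: smooth_on_def)
qed

section \<open>The dilation generated by the normal form\<close>

lemma Basis_triple: "(Basis :: (real \<times> real \<times> real) set) = {(1, 0, 0), (0, 1, 0), (0, 0, 1)}"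
  by (auto simp: Basis_prod_def zero_prod_def)

text \<open>These are the weights of the flow of the normal form at time log s. Only the values on
  the three axis vectors enter the dilation.\<close>

definition normal_weight :: "real \<times> real \<times> real \<Rightarrow> real \<Rightarrow> real" where
  "normal_weight b s = (if b = (0, 0, 1) then 1 else s)"

interpretation normal_flow: dilation normal_weight
proof
  show "smooth_on UNIV (normal_weight b)" for b
  proof -
    have "normal_weight b = (if b = (0, 0, 1) then (\<lambda>s. 1) else (\<lambda>s. s))"
      by (auto simp: fun_eq_iff normal_weight_def)
    then show ?thesis by (simp add: smooth_on_def Ck_on_id)
  qed
  show "\<bar>normal_weight b s\<bar> \<le> 1" if "s \<in> {0..1}" for b s
    using that by (simp add: normal_weight_def)
qed

lemma dil_normal_flow: "normal_flow.dil s (\<xi>, \<eta>, \<zeta>) = (s * \<xi>, s * \<eta>, \<zeta>)"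
  by (simp add: normal_flow.dil_def Basis_triple normal_weight_def)

subsection \<open>The radial equation of the geodesic field\<close>

locale nonvanishing_germ =
  fixes v :: "real \<times> real \<Rightarrow> real" and y0 :: real and U :: "(real \<times> real) set"
  assumes open_U: "open U" and center: "(0, y0) \<in> U"
    and smooth_v: "smooth_on U v" and v_nonzero: "z \<in> U \<Longrightarrow> v z \<noteq> 0"
begin

text \<open>As values of the total derivative in a fixed direction, these partial derivatives are
  smooth by the definition of \<open>smooth_on\<close>; \<open>partial_eq\<close> identifies them
  with the coordinatewise ones on U.\<close>

definition vx :: "real \<times> real \<Rightarrow> real" where "vx z = frechet_derivative v (at z) (1, 0)"
definition vy :: "real \<times> real \<Rightarrow> real" where "vy z = frechet_derivative v (at z) (0, 1)"

lemma Ck_v: "Ck_on k U v"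
  using smooth_v unfolding smooth_on_def by simp

lemma Ck_vx: "Ck_on k U vx"
  using smooth_on_frechet_derivative[OF smooth_v, of "(1, 0)"]
  unfolding vx_def[abs_def] smooth_on_def by simp

lemma Ck_vy: "Ck_on k U vy"
  using smooth_on_frechet_derivative[OF smooth_v, of "(0, 1)"]
  unfolding vy_def[abs_def] smooth_on_def by simp

lemma partial_eq:
  assumes "(x, y) \<in> U"
  shows "partial_x v x y = vx (x, y)" "partial_y v x y = vy (x, y)"
proof -
  define D where "D = frechet_derivative v (at (x, y))"
  have dv: "(v has_derivative D) (at (x, y))"
    using Ck_on_has_derivative[OF Ck_v[of 1, unfolded One_nat_def] assms] by (simp add: D_def)
  have scale: "D (h *\<^sub>R k) = h * D k" for h k
    using linear_cmul[OF has_derivative_linear[OF dv], of h k] by simp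
  have "((\<lambda>s. v (s, y)) has_derivative (\<lambda>h. D (h, 0))) (at x)"
    by (rule has_derivative_compose[where g=v, OF has_derivative_Pair[OF has_derivative_ident has_derivative_const] dv])
  moreover have "(\<lambda>h. D (h, 0)) = (*) (D (1, 0))"
  proof
    fix h :: real
    have "D (h, 0) = D (h *\<^sub>R (1, 0))" by simp
    then show "D (h, 0) = D (1, 0) * h" by (simp only: scale mult.commute)
  qed
  ultimately have "((\<lambda>s. v (s, y)) has_field_derivative D (1, 0)) (at x)"
    unfolding has_field_derivative_def by (rule has_derivative_eq_rhs)
  then show "partial_x v x y = vx (x, y)"
    unfolding partial_x_def vx_def D_def by (rule DERIV_imp_deriv)
  have "((\<lambda>s. v (x, s)) has_derivative (\<lambda>h. D (0, h))) (at y)"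
    by (rule has_derivative_compose[where g=v, OF has_derivative_Pair[OF has_derivative_const has_derivative_ident] dv])
  moreover have "(\<lambda>h. D (0, h)) = (*) (D (0, 1))"
  proof
    fix h :: real
    have "D (0, h) = D (h *\<^sub>R (0, 1))" by simp
    then show "D (0, h) = D (0, 1) * h" by (simp only: scale mult.commute)
  qed
  ultimately have "((\<lambda>s. v (x, s)) has_field_derivative D (0, 1)) (at y)"
    unfolding has_field_derivative_def by (rule has_derivative_eq_rhs)
  then show "partial_y v x y = vy (x, y)"
    unfolding partial_y_def vy_def D_def by (rule DERIV_imp_deriv)
qed

text \<open>At \<open>z = (s, (\<xi>, \<eta>, \<zeta>), (a, q))\<close> the point of the \<open>(x, y)\<close>-plane is \<open>base z\<close>, and \<open>p = s \<eta> e\<^sup>q\<close>. The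
  equations \<open>s da/ds = 2 x\<^sup>2 p\<close> and \<open>s dq/ds = M / (v p) - 1\<close> are both divisible by \<open>s\<close>; the quotient is
  \<open>F = \<xi> F1 + \<eta> F2\<close>, which is small for small \<open>\<xi>\<close> and \<open>\<eta>\<close>.\<close>

definition base :: "real \<times> (real \<times> real \<times> real) \<times> (real \<times> real) \<Rightarrow> real \<times> real" where
  "base z = (fst z * fst (fst (snd z)), y0 + snd (snd (fst (snd z))) + fst (snd (snd z)))"

text \<open>Explicitly, \<open>M / (v p) - 1 = - 2 x vx / v - 2 x^2 p vy / v + p^2 (v^2 - x v
  vx)\<close>. The first summand has the factor \<open>x = s \<xi>\<close> and gives
  \<open>F1\<close>; the others have the factor p, hence \<open>s \<eta>\<close>, and give the
  second component of \<open>F2\<close>.\<close>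

definition F1 :: "real \<times> (real \<times> real \<times> real) \<times> (real \<times> real) \<Rightarrow> real \<times> real" where
  "F1 z = (0, - 2 * vx (base z) / v (base z))"

definition F2 :: "real \<times> (real \<times> real \<times> real) \<times> (real \<times> real) \<Rightarrow> real \<times> real" where
  "F2 z = (2 * fst (base z) ^ 2 * exp (snd (snd (snd z))),
     fst z * fst (snd (fst (snd z))) * exp (snd (snd (snd z))) ^ 2 *
       (v (base z) ^ 2 - fst (base z) * v (base z) * vx (base z))
     - 2 * fst (base z) ^ 2 * exp (snd (snd (snd z))) * vy (base z) / v (base z))"

definition F :: "real \<times> (real \<times> real \<times> real) \<times> (real \<times> real) \<Rightarrow> real \<times> real" where
  "F z = fst (fst (snd z)) *\<^sub>R F1 z + fst (snd (fst (snd z))) *\<^sub>R F2 z"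

definition F' :: "real \<times> (real \<times> real \<times> real) \<times> (real \<times> real) \<Rightarrow>
    real \<times> (real \<times> real \<times> real) \<times> (real \<times> real) \<Rightarrow> real \<times> real" where
  "F' z h = (fst (fst (snd z)) *\<^sub>R frechet_derivative F1 (at z) h + fst (fst (snd h)) *\<^sub>R F1 z)
     + (fst (snd (fst (snd z))) *\<^sub>R frechet_derivative F2 (at z) h + fst (snd (fst (snd h))) *\<^sub>R F2 z)"

definition \<Omega> :: "(real \<times> (real \<times> real \<times> real) \<times> (real \<times> real)) set" where
  "\<Omega> = base -` U"

lemma open_\<Omega>: "open \<Omega>"
  unfolding \<Omega>_def base_def[abs_def] by (intro open_vimage open_U continuous_intros)

lemma Ck_base: "Ck_on k \<Omega> base"
  unfolding base_def[abs_def] by (intro Ck_on_intros open_\<Omega>)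

lemma Ck_base_compose:
  assumes "Ck_on k U f"
  shows "Ck_on k \<Omega> (\<lambda>z. f (base z))"
  by (rule Ck_on_compose[where f=f and g=base, OF open_\<Omega> open_U _ assms Ck_base]) (auto simp: \<Omega>_def)

lemma v_base_nonzero: "z \<in> \<Omega> \<Longrightarrow> v (base z) \<noteq> 0"
  using v_nonzero by (simp add: \<Omega>_def)

lemmas Ck_F_intros = Ck_on_Pair Ck_on_divide Ck_on_const Ck_on_diff Ck_on_mult Ck_on_power Ck_on_exp
  Ck_on_fst Ck_on_snd Ck_on_id open_\<Omega> Ck_base_compose[OF Ck_v] Ck_base_compose[OF Ck_vx]
  Ck_base_compose[OF Ck_vy] Ck_base v_base_nonzero

lemma Ck_F1: "Ck_on k \<Omega> F1"
  unfolding F1_def[abs_def] by (intro Ck_F_intros)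

lemma Ck_F2: "Ck_on k \<Omega> F2"
  unfolding F2_def[abs_def] by (intro Ck_F_intros)

lemma has_derivative_F12:
  "z \<in> \<Omega> \<Longrightarrow> (F1 has_derivative frechet_derivative F1 (at z)) (at z)"
  "z \<in> \<Omega> \<Longrightarrow> (F2 has_derivative frechet_derivative F2 (at z)) (at z)"
  by (rule Ck_on_has_derivative[OF Ck_F1], assumption) (rule Ck_on_has_derivative[OF Ck_F2], assumption)

lemma has_derivative_F: "z \<in> \<Omega> \<Longrightarrow> (F has_derivative F' z) (at z)"
  unfolding F_def[abs_def] F'_def[abs_def]
  by (intro has_derivative_add has_derivative_scaleR has_derivative_fst has_derivative_snd
      has_derivative_ident has_derivative_F12)

lemma smooth_F': "smooth_on \<Omega> (\<lambda>z. F' z h)"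
  unfolding smooth_on_def F'_def
proof (intro allI Ck_on_add Ck_on_scaleR Ck_on_fst Ck_on_snd Ck_on_id Ck_on_const open_\<Omega> Ck_F1 Ck_F2)
  show "Ck_on k \<Omega> (\<lambda>z. frechet_derivative F1 (at z) h)" for k
    using Ck_F1[of "Suc k"] by (simp del: split_paired_All)
  show "Ck_on k \<Omega> (\<lambda>z. frechet_derivative F2 (at z) h)" for k
    using Ck_F2[of "Suc k"] by (simp del: split_paired_All)
qed

text \<open>\<open>F1\<close>, \<open>F2\<close> and their derivatives are bounded on a compact set
  fixed by \<open>\<rho>\<close>, and the prefactors \<open>\<xi>\<close>, \<open>\<eta>\<close> are
  below r, so shrinking r afterwards makes F and its derivative in the unknown as small as desired.
  The second conclusion leaves s unrestricted because the smoothness argument works on an open set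
  of pairs (s, x).\<close>

lemma exists_contraction_radius:
  obtains r \<rho> where "picard normal_weight F F' \<Omega> r \<rho>"
    "\<And>s \<xi> \<eta> \<zeta> a. \<bar>s * \<xi>\<bar> < r \<Longrightarrow> \<bar>\<zeta>\<bar> < r \<Longrightarrow> a \<in> cball 0 \<rho> \<Longrightarrow> (s, (\<xi>, \<eta>, \<zeta>), a) \<in> \<Omega>"
proof -
  obtain \<delta> where "0 < \<delta>" and \<delta>: "ball (0, y0) \<delta> \<subseteq> U"
    using open_U center open_contains_ball by blast
  \<comment> \<open>The three offsets \<open>s * \<xi>\<close>, \<open>\<zeta>\<close> and
    \<open>fst a\<close> from the centre then add up to at most three quarters of
    \<open>\<delta>\<close>.\<close>
  define \<rho> where "\<rho> = \<delta> / 4"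
  have "0 < \<rho>" using \<open>0 < \<delta>\<close> by (simp add: \<rho>_def)
  have in_\<Omega>: "(s, (\<xi>, \<eta>, \<zeta>), a) \<in> \<Omega>" if "\<bar>s * \<xi>\<bar> \<le> \<rho>" "\<bar>\<zeta>\<bar> \<le> \<rho>" "a \<in> cball 0 \<rho>"
    for s \<xi> \<eta> \<zeta> and a :: "real \<times> real"
  proof -
    have "\<bar>fst a\<bar> \<le> \<rho>" using that(3) norm_fst_le[of "fst a" "snd a"] by simp
    then have "norm (s * \<xi>) + norm (\<zeta> + fst a) < \<delta>"
      using that \<open>0 < \<delta>\<close> by (simp add: \<rho>_def)
    then have "norm (s * \<xi>, \<zeta> + fst a) < \<delta>"
      using norm_Pair_le[of "s * \<xi>" "\<zeta> + fst a"] by linarith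
    then have "dist (s * \<xi>, y0 + \<zeta> + fst a) (0, y0) < \<delta>"
      by (simp add: dist_norm)
    then have "(s * \<xi>, y0 + \<zeta> + fst a) \<in> ball (0, y0) \<delta>"
      unfolding mem_ball by (subst dist_commute)
    then show ?thesis using \<delta> by (auto simp: \<Omega>_def base_def)
  qed
  have coord: "\<bar>\<xi>\<bar> \<le> norm (\<xi>, \<eta>, \<zeta>) \<and> \<bar>\<eta>\<bar> \<le> norm (\<xi>, \<eta>, \<zeta>) \<and> \<bar>\<zeta>\<bar> \<le> norm (\<xi>, \<eta>, \<zeta>)"
    for \<xi> \<eta> \<zeta> :: real
  proof (intro conjI)
    show "\<bar>\<xi>\<bar> \<le> norm (\<xi>, \<eta>, \<zeta>)"
      using norm_fst_le[of \<xi> "(\<eta>, \<zeta>)"] by (simp only: real_norm_def)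
    show "\<bar>\<eta>\<bar> \<le> norm (\<xi>, \<eta>, \<zeta>)"
      using order_trans[OF norm_fst_le[of \<eta> \<zeta>] norm_snd_le[of "(\<eta>, \<zeta>)" \<xi>]] by (simp only: real_norm_def)
    show "\<bar>\<zeta>\<bar> \<le> norm (\<xi>, \<eta>, \<zeta>)"
      using order_trans[OF norm_snd_le[of \<zeta> \<eta>] norm_snd_le[of "(\<eta>, \<zeta>)" \<xi>]] by (simp only: real_norm_def)
  qed
  define K where "K = {0..1::real} \<times> cball (0 :: real \<times> real \<times> real) \<rho> \<times> cball (0 :: real \<times> real) \<rho>"
  have "compact K" unfolding K_def by (intro compact_Times compact_Icc compact_cball)
  have K_\<Omega>: "K \<subseteq> \<Omega>"
  proof
    fix z assume "z \<in> K"
    moreover obtain s \<xi> \<eta> \<zeta> a where z: "z = (s, (\<xi>, \<eta>, \<zeta>), a)" by (metis surj_pair)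
    ultimately have s: "s \<in> {0..1}" and x: "norm (\<xi>, \<eta>, \<zeta>) \<le> \<rho>" and a: "a \<in> cball 0 \<rho>"
      unfolding K_def by auto
    have "\<bar>s * \<xi>\<bar> \<le> 1 * \<bar>\<xi>\<bar>" unfolding abs_mult using s by (intro mult_right_mono) auto
    then show "z \<in> \<Omega>"
      unfolding z using coord[of \<xi> \<eta> \<zeta>] x by (intro in_\<Omega> a) linarith+
  qed
  have bound: "\<exists>C\<ge>0. \<forall>z\<in>K. norm (f z) \<le> C \<and> (\<forall>h. norm (frechet_derivative f (at z) h) \<le> C * norm h)"
    if "\<And>k. Ck_on k \<Omega> f" for f :: "real \<times> (real \<times> real \<times> real) \<times> (real \<times> real) \<Rightarrow> real \<times> real"
    using Ck_on_compact_bound[OF \<open>compact K\<close> K_\<Omega> that] .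
  obtain B1 where B1: "0 \<le> B1" "\<And>z. z \<in> K \<Longrightarrow> norm (F1 z) \<le> B1"
    "\<And>z h. z \<in> K \<Longrightarrow> norm (frechet_derivative F1 (at z) h) \<le> B1 * norm h"
    using bound[OF Ck_F1] by blast
  obtain B2 where B2: "0 \<le> B2" "\<And>z. z \<in> K \<Longrightarrow> norm (F2 z) \<le> B2"
    "\<And>z h. z \<in> K \<Longrightarrow> norm (frechet_derivative F2 (at z) h) \<le> B2 * norm h"
    using bound[OF Ck_F2] by blast
  \<comment> \<open>The inner minimum serves two purposes: with \<open>\<rho>\<close> it bounds F by
    \<open>\<rho> / 2\<close>, with 1 it gives the contraction constant 1/2. The outer one keeps the
    points in K, and the summand 1 keeps the denominator positive.\<close>
  define r where "r = min \<rho> (min \<rho> 1 / (2 * (B1 + B2 + 1)))"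
  have "0 < r" using \<open>0 < \<rho>\<close> B1(1) B2(1) by (simp add: r_def)
  have "r \<le> \<rho>" by (simp add: r_def)
  have "r * (B1 + B2) \<le> min \<rho> 1 / (2 * (B1 + B2 + 1)) * (B1 + B2 + 1)"
    using B1(1) B2(1) \<open>0 < \<rho>\<close> by (intro mult_mono) (auto simp: r_def)
  also have "\<dots> = min \<rho> 1 / 2" using B1(1) B2(1) by (simp add: field_simps)
  finally have small: "r * (B1 + B2) \<le> min \<rho> 1 / 2" .
  have sum_le: "norm (\<xi> *\<^sub>R p + \<eta> *\<^sub>R q) \<le> r * (B1 + B2) * k"
    if "norm (\<xi>, \<eta>, \<zeta>) < r" "norm p \<le> B1 * k" "norm q \<le> B2 * k" "0 \<le> k"
    for \<xi> \<eta> \<zeta> k :: real and p q :: "real \<times> real"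
  proof -
    have "norm (\<xi> *\<^sub>R p + \<eta> *\<^sub>R q) \<le> \<bar>\<xi>\<bar> * norm p + \<bar>\<eta>\<bar> * norm q"
      using norm_triangle_ineq[of "\<xi> *\<^sub>R p" "\<eta> *\<^sub>R q"] by simp
    also have "\<dots> \<le> r * (B1 * k) + r * (B2 * k)"
    proof (intro add_mono mult_mono that(2,3) norm_ge_zero)
      show "\<bar>\<xi>\<bar> \<le> r" "\<bar>\<eta>\<bar> \<le> r" using coord[of \<xi> \<eta> \<zeta>] that(1) by simp_all
    qed (use \<open>0 < r\<close> in simp_all)
    finally show ?thesis by (simp add: algebra_simps)
  qed
  have "picard normal_weight F F' \<Omega> r \<rho>"
  proof
    show "(F has_derivative F' z) (at z)" if "z \<in> \<Omega>" for z by (rule has_derivative_F[OF that])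
    show "continuous_on \<Omega> (\<lambda>z. F' z h)" for h
      using smooth_F'[of h] Ck_on_imp_continuous_on unfolding smooth_on_def by blast
    have "cball (0 :: real \<times> real \<times> real) r \<subseteq> cball 0 \<rho>" using \<open>r \<le> \<rho>\<close> by auto
    then show "{0..1} \<times> cball 0 r \<times> cball 0 \<rho> \<subseteq> \<Omega>" using K_\<Omega> unfolding K_def by blast
    show "0 < r" by fact
    show "0 \<le> \<rho>" using \<open>0 < \<rho>\<close> by simp
    fix s :: real and x :: "real \<times> real \<times> real" and a m :: "real \<times> real"
    assume s: "s \<in> {0..1}" and x: "x \<in> ball 0 r" and a: "a \<in> cball 0 \<rho>"
    obtain \<xi> \<eta> \<zeta> where x_eq: "x = (\<xi>, \<eta>, \<zeta>)" by (metis surj_pair)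
    have n: "norm (\<xi>, \<eta>, \<zeta>) < r" using x unfolding x_eq by simp
    have zK: "(s, x, a) \<in> K" using s x a \<open>r \<le> \<rho>\<close> unfolding K_def by auto
    have "norm (F (s, x, a)) \<le> r * (B1 + B2) * 1"
      using sum_le[OF n, of "F1 (s, x, a)" 1 "F2 (s, x, a)"] B1(2)[OF zK] B2(2)[OF zK]
      by (simp add: F_def x_eq)
    also have "\<dots> \<le> \<rho>" using small \<open>0 < \<rho>\<close> by simp
    finally show "norm (F (s, x, a)) \<le> \<rho>" .
    \<comment> \<open>In a direction of the unknown the prefactors \<open>\<xi>\<close> and
      \<open>\<eta>\<close> are constant, so only the terms multiplied by them remain.\<close>
    have "norm (F' (s, x, a) (0, 0, m)) \<le> r * (B1 + B2) * norm (0 :: real, 0 :: real \<times> real \<times> real, m)"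
      using sum_le[OF n B1(3)[OF zK] B2(3)[OF zK] norm_ge_zero, of "(0, 0, m)"]
      by (simp add: F'_def x_eq)
    also have "\<dots> = r * (B1 + B2) * norm m" by (simp add: norm_Pair)
    also have "\<dots> \<le> (1/2) * norm m" using small by (intro mult_right_mono) auto
    finally show "norm (F' (s, x, a) (0, 0, m)) \<le> norm m / 2" by simp
  qed
  moreover have "(s, (\<xi>, \<eta>, \<zeta>), a) \<in> \<Omega>" if "\<bar>s * \<xi>\<bar> < r" "\<bar>\<zeta>\<bar> < r" "a \<in> cball 0 \<rho>" for s \<xi> \<eta> \<zeta> a
    using that \<open>r \<le> \<rho>\<close> by (intro in_\<Omega>) auto
  ultimately show thesis by (rule that)
qed

end

subsection \<open>The conjugacy\<close>

context nonvanishing_germ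
begin

text \<open>\<open>F1\<close> and \<open>F2\<close> see s, \<open>\<xi>\<close> and
  \<open>\<eta>\<close> only through the products \<open>s * \<xi>\<close> and
  \<open>s * \<eta>\<close>; the factor \<open>\<tau>\<close> comes from the prefactors
  \<open>\<xi>\<close> and \<open>\<eta>\<close> in F.\<close>

lemma F_homogeneous:
  "F (s, normal_flow.dil \<tau> (\<xi>, \<eta>, \<zeta>), a) = \<tau> *\<^sub>R F (\<tau> * s, (\<xi>, \<eta>, \<zeta>), a)"
proof -
  have "base (s, (\<tau> * \<xi>, \<tau> * \<eta>, \<zeta>), a) = base (\<tau> * s, (\<xi>, \<eta>, \<zeta>), a)"
    by (simp add: base_def mult_ac)
  then have "F1 (s, (\<tau> * \<xi>, \<tau> * \<eta>, \<zeta>), a) = F1 (\<tau> * s, (\<xi>, \<eta>, \<zeta>), a)"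
    "F2 (s, (\<tau> * \<xi>, \<tau> * \<eta>, \<zeta>), a) = F2 (\<tau> * s, (\<xi>, \<eta>, \<zeta>), a)"
    by (simp_all add: F1_def F2_def mult_ac)
  then show ?thesis by (simp add: F_def dil_normal_flow scaleR_right_distrib)
qed

text \<open>The radial vector \<open>(fst x, fst (snd x), 0)\<close> is the normal form at x, so the
  derivative identity is the differential equation for u. The last clause serves the invertibility
  of the conjugacy at 0; it holds since \<open>F1\<close> has first component 0 and that of
  \<open>F2\<close> carries the factor x^2, which vanishes at the origin.\<close>

lemma exists_radial_solution:
  obtains r u where "0 < r" "smooth_on (ball 0 r) u" "u 0 = 0"
    "\<And>x. x \<in> ball 0 r \<Longrightarrow> (1, x, u x) \<in> \<Omega>"
    "\<And>x. x \<in> ball 0 r \<Longrightarrow>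
      frechet_derivative u (at x) (fst x, fst (snd x), 0) = F (1, x, u x)"
    "\<And>h. fst (frechet_derivative u (at 0) h) = 0"
proof -
  obtain r \<rho> where p: "picard normal_weight F F' \<Omega> r \<rho>"
    and in_\<Omega>: "\<And>s \<xi> \<eta> \<zeta> a. \<bar>s * \<xi>\<bar> < r \<Longrightarrow> \<bar>\<zeta>\<bar> < r \<Longrightarrow> a \<in> cball 0 \<rho> \<Longrightarrow> (s, (\<xi>, \<eta>, \<zeta>), a) \<in> \<Omega>"
    using exists_contraction_radius by blast
  interpret P: picard normal_weight F F' \<Omega> r \<rho> by (rule p)
  obtain u where u: "P.admissible u" "\<And>x. x \<in> ball 0 r \<Longrightarrow> u x = P.step u x"
    using P.fixpoint_exists by blast
  have r0: "0 \<in> ball (0 :: real \<times> real \<times> real) r" using P.r_pos by simp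
  \<comment> \<open>Requiring the dilated point to stay in the ball replaces the constraint
    \<open>s \<in> {0..1}\<close> by an open one.\<close>
  define \<Theta> where "\<Theta> = (snd :: real \<times> real \<times> real \<times> real \<Rightarrow> _) -` ball 0 r \<inter>
    (\<lambda>z. normal_flow.dil (fst z) (snd z)) -` ball 0 r"
  have smooth_u: "smooth_on (ball 0 r) u"
  proof (rule P.fixpoint_smooth[OF u open_\<Omega> smooth_F', of \<Theta>])
    have "open ((snd :: real \<times> real \<times> real \<times> real \<Rightarrow> _) -` ball 0 r)"
      by (intro open_vimage open_ball continuous_on_snd continuous_on_id)
    moreover have "open ((\<lambda>z. normal_flow.dil (fst z) (snd z)) -` ball 0 r)"
      by (rule open_vimage[OF open_ball Ck_on_imp_continuous_on[OF normal_flow.Ck_on_dil]])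
    ultimately show "open \<Theta>" unfolding \<Theta>_def by (rule open_Int)
    show "{0..1} \<times> ball 0 r \<subseteq> \<Theta>" unfolding \<Theta>_def using normal_flow.dil_in_ball by auto
    show "normal_flow.dil (fst z) (snd z) \<in> ball 0 r" if "z \<in> \<Theta>" for z
      using that unfolding \<Theta>_def by simp
    show "(s, x, a) \<in> \<Omega>" if sx: "(s, x) \<in> \<Theta>" and a: "a \<in> cball 0 \<rho>" for s x a
    proof -
      obtain \<xi> \<eta> \<zeta> where x: "x = (\<xi>, \<eta>, \<zeta>)" by (metis surj_pair)
      have "norm (s * \<xi>, s * \<eta>, \<zeta>) < r" using sx unfolding \<Theta>_def x by (simp add: dil_normal_flow)
      then have "norm (s * \<xi>) < r" "norm \<zeta> < r"
        using norm_fst_le[of "s * \<xi>" "(s * \<eta>, \<zeta>)"] norm_snd_le[of "(s * \<eta>, \<zeta>)" "s * \<xi>"]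
          norm_snd_le[of \<zeta> "s * \<eta>"] by linarith+
      then show ?thesis unfolding x by (intro in_\<Omega> a) simp_all
    qed
  qed auto
  define u' where "u' x = frechet_derivative u (at x)" for x
  have du: "(u has_derivative u' x) (at x)" if "x \<in> ball 0 r" for x
    unfolding u'_def using smooth_u that Ck_on_has_derivative[of 0 "ball 0 r" u x]
    unfolding smooth_on_def by simp
  have cu': "continuous_on (ball 0 r) (\<lambda>x. u' x h)" for h
    using smooth_on_frechet_derivative[OF smooth_u, of h] Ck_on_imp_continuous_on
    unfolding u'_def smooth_on_def by blast
  have F_0: "F (s, 0, a) = 0" for s a by (simp add: F_def)
  have u_0: "u 0 = 0" using u(2)[OF r0] by (simp add: P.step_def F_0)
  have "(1, x, u x) \<in> \<Omega>" if "x \<in> ball 0 r" for x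
    using P.admissible_le[OF u(1) that] that by (intro P.in_dom) auto
  moreover have "u' x (fst x, fst (snd x), 0) = F (1, x, u x)" if x: "x \<in> ball 0 r" for x
  proof (rule P.fixpoint_radial_derivative[OF u x du[OF x]])
    obtain \<xi> \<eta> \<zeta> where x_eq: "x = (\<xi>, \<eta>, \<zeta>)" by (metis surj_pair)
    show "F (s, normal_flow.dil \<tau> x, a) = \<tau> *\<^sub>R F (\<tau> * s, x, a)" for s \<tau> a
      unfolding x_eq by (rule F_homogeneous)
    show "normal_flow.dil s (normal_flow.dil \<tau> x) = normal_flow.dil (\<tau> * s) x" for s \<tau>
      unfolding x_eq by (simp add: dil_normal_flow mult_ac)
    show "normal_flow.dil 1 x = x" unfolding x_eq by (simp add: dil_normal_flow)
    show "((\<lambda>\<tau>. normal_flow.dil \<tau> x) has_vector_derivative (fst x, fst (snd x), 0)) (at 1)"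
      unfolding x_eq dil_normal_flow has_vector_derivative_def
      by (auto intro!: derivative_eq_intros)
  qed auto
  moreover have "fst (u' 0 h) = 0" for h
  proof -
    define f where "f s = F' (s, 0, u (normal_flow.dil s 0))
        (0, h, u' (normal_flow.dil s 0) (normal_flow.dil s h))" for s
    have dil_0: "normal_flow.dil s 0 = 0" for s
      using linear_0[OF bounded_linear.linear[OF normal_flow.bounded_linear_dil]] .
    have "continuous_on {0..1} f"
      unfolding f_def by (rule P.has_derivative_step(3)[OF u(1) du cu' r0])
    then have "integral {0..1} (fst \<circ> f) = fst (integral {0..1} f)"
      by (intro integral_linear integrable_continuous_interval bounded_linear_fst)
    moreover have "fst \<circ> f = (\<lambda>s. 0)"
      by (rule ext) (simp add: f_def F'_def dil_0 u_0 F1_def F2_def base_def)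
    moreover have "u' 0 h = integral {0..1} f"
      unfolding f_def by (rule P.fixpoint_derivative[OF u du cu' r0])
    ultimately show ?thesis by simp
  qed
  ultimately show thesis
    using that P.r_pos smooth_u u_0 unfolding u'_def by blast
qed

theorem geodesic_field_equivalent_normal_form:
  "smoothly_orbitally_equivalent (geodesic_field v) (0, y0, 0) normal_form (0, 0, 0)"
proof -
  obtain r u where "0 < r" and smooth_u: "smooth_on (ball 0 r) u" and u_0: "u 0 = 0"
    and in_\<Omega>: "\<And>x. x \<in> ball 0 r \<Longrightarrow> (1, x, u x) \<in> \<Omega>"
    and radial: "\<And>x. x \<in> ball 0 r \<Longrightarrow>
      frechet_derivative u (at x) (fst x, fst (snd x), 0) = F (1, x, u x)"
    and flat: "\<And>h. fst (frechet_derivative u (at 0) h) = 0"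
    using exists_radial_solution by blast
  define u' where "u' x = frechet_derivative u (at x)" for x
  have du: "(u has_derivative u' x) (at x)" if "x \<in> ball 0 r" for x
    unfolding u'_def using smooth_u that Ck_on_has_derivative[of 0 "ball 0 r" u x]
    unfolding smooth_on_def by simp
  define \<Psi> where "\<Psi> x = (fst x, y0 + snd (snd x) + fst (u x), fst (snd x) * exp (snd (u x)))" for x
  define \<Psi>' where "\<Psi>' x h = (fst h, snd (snd h) + fst (u' x h),
    fst (snd x) * (exp (snd (u x)) * snd (u' x h)) + fst (snd h) * exp (snd (u x)))" for x h
  have d\<Psi>: "(\<Psi> has_derivative \<Psi>' x) (at x)" if "x \<in> ball 0 r" for x
    unfolding \<Psi>_def[abs_def] \<Psi>'_def[abs_def]
    by (auto intro!: derivative_eq_intros du[OF that] simp: algebra_simps)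
  have frechet_\<Psi>: "frechet_derivative \<Psi> (at x) = \<Psi>' x" if "x \<in> ball 0 r" for x
    using frechet_derivative_at[OF d\<Psi>[OF that]] by simp
  have "Ck_on k (ball 0 r) u" for k using smooth_u by (simp add: smooth_on_def)
  then have Ck_\<Psi>: "Ck_on k (ball 0 r) \<Psi>" for k
    unfolding \<Psi>_def[abs_def]
    by (intro Ck_on_Pair Ck_on_add Ck_on_mult Ck_on_exp Ck_on_fst Ck_on_snd Ck_on_id Ck_on_const open_ball)
  have bl: "blinfun_apply (Blinfun (\<Psi>' x)) h = \<Psi>' x h" if "x \<in> ball 0 r" for x h
    using has_derivative_bounded_linear[OF d\<Psi>[OF that]] by (simp add: bounded_linear_Blinfun_apply)
  have "continuous_on (ball 0 r) (\<lambda>x. frechet_derivative \<Psi> (at x) h)" for h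
    using Ck_\<Psi>[of "Suc 0"] by (simp del: split_paired_All)
  then have "continuous_on (ball 0 r) (\<lambda>x. blinfun_apply (Blinfun (\<Psi>' x)) h)" for h
    by (rule continuous_on_eq) (simp add: bl frechet_\<Psi> del: mem_ball mem_ball_0)
  then have cont: "continuous_on (ball 0 r) (\<lambda>x. Blinfun (\<Psi>' x))"
    by (rule continuous_on_blinfun_componentwise)
  have r0: "0 \<in> ball (0 :: real \<times> real \<times> real) r" using \<open>0 < r\<close> by simp
  \<comment> \<open>At the origin u and the derivative of its first component vanish, so
    \<open>\<Psi>' 0\<close> just interchanges the last two coordinates (y follows
    \<open>\<zeta>\<close>, p follows \<open>\<eta>\<close>) and is its own inverse.\<close>
  define swap where "swap h = (fst h, snd (snd h), fst (snd h))" for h :: "real \<times> real \<times> real"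
  have "bounded_linear swap"
    unfolding swap_def[abs_def]
    by (intro bounded_linear_Pair bounded_linear_fst bounded_linear_compose[OF bounded_linear_fst bounded_linear_snd]
        bounded_linear_compose[OF bounded_linear_snd bounded_linear_snd])
  then have "blinfun_apply (Blinfun swap o\<^sub>L Blinfun (\<Psi>' 0)) h = h" for h
    using flat[of h] bl[OF r0, of h]
    by (simp add: bounded_linear_Blinfun_apply swap_def \<Psi>'_def u_0 u'_def)
  then have inv: "Blinfun swap o\<^sub>L Blinfun (\<Psi>' 0) = id_blinfun"
    by (intro blinfun_eqI) simp
  have der: "(\<Psi> has_derivative blinfun_apply (Blinfun (\<Psi>' x))) (at x)" if "x \<in> ball 0 r" for x
    by (rule has_derivative_eq_rhs[OF d\<Psi>[OF that]]) (rule ext, rule bl[OF that, symmetric])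
  obtain S T g g' where S: "open S" "S \<subseteq> ball 0 r" "0 \<in> S" and T: "open T" "\<Psi> 0 \<in> T"
    and homeo: "homeomorphism S T \<Psi> g"
    and dg: "\<And>y. y \<in> T \<Longrightarrow> (g has_derivative (g' y)) (at y)"
    and g': "\<And>y. y \<in> T \<Longrightarrow> g' y = inv (blinfun_apply (Blinfun (\<Psi>' (g y))))"
    and bij: "\<And>y. y \<in> T \<Longrightarrow> bij (blinfun_apply (Blinfun (\<Psi>' (g y))))"
    by (rule inverse_function_theorem[OF open_ball der cont r0 inv]) (assumption, rule that)
  have gT: "g y \<in> S" if "y \<in> T" for y using homeo that unfolding homeomorphism_def by blast
  then have g_ball: "g y \<in> ball 0 r" if "y \<in> T" for y using S(2) that by blast
  have left_inv: "g' y (\<Psi>' (g y) h) = h" if "y \<in> T" for y h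
    using inv_f_f[OF bij_is_inj[OF bij[OF that]], of h] g'[OF that] bl[OF g_ball[OF that]] by simp
  have right_inv: "\<Psi>' (g y) (g' y h) = h" if "y \<in> T" for y h
    using surj_f_inv_f[OF bij_is_surj[OF bij[OF that]], of h] g'[OF that] bl[OF g_ball[OF that]] by simp
  have "smooth_on T g"
  proof (rule smooth_on_inverse_triple[OF S(1) T(1) _ _ _ dg])
    show "smooth_on S \<Psi>"
      using Ck_on_subset[OF Ck_\<Psi> S(2)] by (simp add: smooth_on_def)
    show "g ` T \<subseteq> S" using gT by blast
    show "fst (\<Psi> x) = fst x" for x by (simp add: \<Psi>_def)
  qed (simp_all add: frechet_\<Psi>[OF g_ball] left_inv right_inv)
  moreover have "smooth_on S \<Psi>"
    using Ck_on_subset[OF Ck_\<Psi> S(2)] by (simp add: smooth_on_def)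
  \<comment> \<open>The equivalence starts in (x, y, p)-space, so the local inverse g plays the part
    of the diffeomorphism and \<open>\<Psi>\<close> that of its inverse.\<close>
  ultimately have diffeo: "diffeomorphism T S g \<Psi>"
    unfolding diffeomorphism_def using S(1) T(1) homeomorphism_symD[OF homeo] by blast
  have \<Psi>_0: "\<Psi> 0 = (0, y0, 0)" by (simp add: \<Psi>_def u_0)
  have g_0: "g (0, y0, 0) = (0, 0, 0)"
    using homeo S(3) unfolding homeomorphism_def \<Psi>_0[symmetric] by (simp add: zero_prod_def)
  have \<Psi>_g: "\<Psi> (g y) = y" if "y \<in> T" for y using homeo that unfolding homeomorphism_def by blast
  have in_U: "(fst (\<Psi> x), fst (snd (\<Psi> x))) \<in> U" if "x \<in> ball 0 r" for x
    using in_\<Omega>[OF that] by (simp add: \<Omega>_def base_def \<Psi>_def)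
  have field: "geodesic_field v (\<Psi> x)
      = v (fst (\<Psi> x), fst (snd (\<Psi> x))) *\<^sub>R \<Psi>' x (fst x, fst (snd x), 0)" if x: "x \<in> ball 0 r" for x
  proof -
    obtain \<xi> \<eta> \<zeta> where x_eq: "x = (\<xi>, \<eta>, \<zeta>)" by (metis surj_pair)
    obtain a q where u_eq: "u x = (a, q)" by (metis surj_pair)
    define p where "p = \<eta> * exp q"
    define Y where "Y = y0 + \<zeta> + a"
    have \<Psi>_x: "\<Psi> x = (\<xi>, Y, p)" by (simp add: \<Psi>_def u_eq, simp add: x_eq p_def Y_def)
    have U: "(\<xi>, Y) \<in> U" using in_U[OF x] by (simp add: \<Psi>_x)
    have v0: "v (\<xi>, Y) \<noteq> 0" using v_nonzero[OF U] .
    have "u' x (\<xi>, \<eta>, 0) = F (1, x, u x)" using radial[OF x] by (simp add: u'_def x_eq)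
    also have "\<dots> = (2 * \<xi>^2 * p, - 2 * \<xi> * vx (\<xi>, Y) / v (\<xi>, Y) + p^2 * (v (\<xi>, Y)^2 - \<xi> * v (\<xi>, Y) * vx (\<xi>, Y))
        - 2 * \<xi>^2 * p * vy (\<xi>, Y) / v (\<xi>, Y))"
      unfolding u_eq by (simp add: x_eq F_def F1_def F2_def base_def p_def Y_def power2_eq_square algebra_simps)
    finally have u'_x: "u' x (\<xi>, \<eta>, 0) = (2 * \<xi>^2 * p, - 2 * \<xi> * vx (\<xi>, Y) / v (\<xi>, Y) + p^2 * (v (\<xi>, Y)^2 - \<xi> * v (\<xi>, Y) * vx (\<xi>, Y))
        - 2 * \<xi>^2 * p * vy (\<xi>, Y) / v (\<xi>, Y))" .
    have "\<Psi>' x (\<xi>, \<eta>, 0) = (\<xi>, 2 * \<xi>^2 * p, p * snd (u' x (\<xi>, \<eta>, 0)) + p)"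
      unfolding \<Psi>'_def u_eq u'_x by (simp add: x_eq p_def)
    \<comment> \<open>Multiplying the equation for q by v p clears the quotient M / (v p), so the
      identity holds at p = 0 as well.\<close>
    moreover have "v (\<xi>, Y) * (p * snd (u' x (\<xi>, \<eta>, 0)) + p) = M_poly v \<xi> Y p"
      unfolding u'_x using v0
      by (simp add: M_poly_def mu_def numeral_3_eq_3 partial_eq[OF U])
        (simp add: field_simps power2_eq_square)
    ultimately show ?thesis
      unfolding \<Psi>_x using x_eq by (simp add: geodesic_field_def mult_ac)
  qed
  \<comment> \<open>The orbital factor is v itself, undoing the division of the field by v.\<close>
  define \<phi> where "\<phi> z = v (fst z, fst (snd z))" for z :: "real \<times> real \<times> real"
  have T_U: "(fst y, fst (snd y)) \<in> U" if "y \<in> T" for y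
    using in_U[OF g_ball[OF that]] by (simp add: \<Psi>_g[OF that])
  have "smooth_on T \<phi>"
    unfolding smooth_on_def \<phi>_def
  proof
    show "Ck_on k T (\<lambda>z. v (fst z, fst (snd z)))" for k
      by (rule Ck_on_compose[where f=v and g="\<lambda>z. (fst z, fst (snd z))", OF T(1) open_U _ Ck_v])
        (use T_U in \<open>auto intro!: Ck_on_Pair Ck_on_fst Ck_on_snd Ck_on_id T(1)\<close>)
  qed
  moreover have "\<forall>y\<in>T. \<phi> y \<noteq> 0" using v_nonzero T_U by (simp add: \<phi>_def)
  moreover have "\<forall>y\<in>T. frechet_derivative g (at y) (geodesic_field v y) = \<phi> y *\<^sub>R normal_form (g y)"
  proof
    fix y assume y: "y \<in> T"
    let ?x = "g y"
    have "frechet_derivative g (at y) (geodesic_field v y) = g' y (geodesic_field v (\<Psi> ?x))"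
      using frechet_derivative_at[OF dg[OF y]] \<Psi>_g[OF y] by simp
    also have "\<dots> = \<phi> y *\<^sub>R g' y (\<Psi>' ?x (fst ?x, fst (snd ?x), 0))"
      using field[OF g_ball[OF y]] linear_cmul[OF has_derivative_linear[OF dg[OF y]]]
      by (simp add: \<Psi>_g[OF y] \<phi>_def)
    also have "\<dots> = \<phi> y *\<^sub>R normal_form ?x"
      unfolding left_inv[OF y] by (simp add: normal_form_def split_beta)
    finally show "frechet_derivative g (at y) (geodesic_field v y) = \<phi> y *\<^sub>R normal_form ?x" .
  qed
  moreover have "(0, y0, 0) \<in> T" using T(2) by (simp add: \<Psi>_0)
  ultimately show ?thesis
    unfolding smoothly_orbitally_equivalent_def using diffeo g_0 by blast
qed

end

theorem theorem11:
  fixes v :: "real \<times> real \<Rightarrow> real" and y0 :: real and U :: "(real \<times> real) set"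
  assumes "open U" and "(0, y0) \<in> U"
    and "smooth_on U v"
    and "\<forall>z\<in>U. v z \<noteq> 0"
  shows "smoothly_orbitally_equivalent (geodesic_field v) (0, y0, 0) normal_form (0, 0, 0)"
proof -
  interpret nonvanishing_germ v y0 U
    by unfold_locales (use assms in auto)
  show ?thesis by (rule geodesic_field_equivalent_normal_form)
qed

end
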